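(* Let $F=\mathbb R$ with the absolute value, $T>0$, and $C=[\alpha,\beta]$ with real $\alpha<\beta$. For every $N\in\mathbb N$, $$D_N=\frac1{2N},$$ where $D_N$ is the minimax error for the complementary variable defined in the context. Moreover, the value is attained by the sampled equal-variation encoder $f_N^\star$ (defined in the context), i.e. $D(f_N^\star)=D_N$.
   Context: Variation and norms: $\operatorname{Var}(u;[a,b])=\sup\sum_j|u(t_j)-u(t_{j-1})|$ over partitions of $[a,b]$; $\|u\|_{BV,0}:=|u(0)|+\operatorname{Var}(u;[0,T])$. Elements of $W^{1,1}(0,T)$ (real-valued) are identified with their absolutely continuous representatives on $[0,T]$. History operator: $P_C$ is the projection onto $C=[\alpha,\beta]$ and $N_C(\sigma)=\{\nu\in\mathbb R:\nu(z-\sigma)\le0\ \forall z\in C\}$. It is a known result that for every $\pi\in W^{1,1}(0,T)$ there is a unique $\sigma\in W^{1,1}(0,T)$ with $\sigma(0)=P_C(\pi(0))$, $\sigma(t)\in C$ for all $t\in[0,T]$ and $\dot\pi(t)-\dot\sigma(t)\in N_C(\sigma(t))$ for a.e. $t$. Set $\mathcal P(\pi):=\sigma$ and define the complementary variable $W(\pi):=\pi-\mathcal P(\pi)$. Step functions: $\mathcal Z_N$ is the set of functions $z:[0,T]\to\mathbb R$ for which there exist $M\le N$, a partition $0=t_0<\dots<t_M=T$ and values $z_0,\dots,z_M\in\mathbb R$ with $z(t)=z_{k-1}$ for $t\in[t_{k-1},t_k)$, $k=1,\dots,M$, and $z(T)=z_M$. Decoder: for such $z$, $g_N^\star(z)$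 is the step function with value $\sigma_{k-1}$ on $[t_{k-1},t_k)$ and $\sigma_M$ at $T$, where $\sigma_0:=P_C(z_0)$, $\sigma_k:=P_C(\sigma_{k-1}+z_k-z_{k-1})$, $k=1,\dots,M$ (independent of the partition used to represent $z$). Errors: an encoder is an arbitrary map $f_N:W^{1,1}(0,T)\to\mathcal Z_N$; the decoded complementary variable is $W_N(\pi):=f_N(\pi)-g_N^\star(f_N(\pi))$, and $$D(f_N):=\sup_{\pi\in W^{1,1}(0,T)\setminus\{0\}}\frac{\|W(\pi)-W_N(\pi)\|_{L^\infty(0,T)}}{\|\pi\|_{BV,0}},\qquad D_N:=\inf_{f_N}D(f_N),$$ the infimum being over all encoders. Sampled equal-variation encoder $f_N^\star$: let $V:=\operatorname{Var}(\pi;[0,T])$ and $a(t):=\operatorname{Var}(\pi;[0,t])$. If $V=0$, $f_N^\star(\pi)\equiv\pi(0)$. If $V>0$, let $t_k:=\min\{t\in[0,T]:a(t)=kV/N\}$ for $k=0,\dots,N-1$, $t_N:=T$, choose $\tau_k\in[t_{k-1},t_k]$ with $a(\tau_k)=\frac{(2k-1)V}{2N}$, $k=1,\dots,N$ (any such choice), and set $f_N^\star(\pi)(t):=\pi(\tau_k)$ for $t\in[t_{k-1},t_k)$ and $f_N^\star(\pi)(T):=\pi(T)$. *)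

theory Defs
  imports "HOL-Analysis.Analysis" "HOL-Probability.Essential_Supremum"
begin

text \<open>
  Functions on \<open>[0,T]\<close> are modelled as functions \<open>real \<Rightarrow> real\<close> that are \<open>extensional\<close> on
  \<open>{0..T}\<close>, so that equality in HOL is equality on \<open>[0,T]\<close>.
\<close>

definition absolutely_continuous_fun :: "real \<Rightarrow> real \<Rightarrow> (real \<Rightarrow> real) \<Rightarrow> bool" where
  "absolutely_continuous_fun a b u \<longleftrightarrow>
     (\<forall>\<epsilon>>0. \<exists>\<delta>>0. \<forall>(n::nat) (x::nat \<Rightarrow> real) y.
        (\<forall>i<n. a \<le> x i \<and> x i \<le> y i \<and> y i \<le> b) \<and>
        disjoint_family_on (\<lambda>i. {x i<..<y i}) {..<n} \<and>
        (\<Sum>i<n. y i - x i) < \<delta>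
        \<longrightarrow> (\<Sum>i<n. \<bar>u (y i) - u (x i)\<bar>) < \<epsilon>)"

text \<open>The absolutely continuous representatives of the elements of \<open>W\<^sup>1\<^sup>,\<^sup>1(0,T)\<close>.\<close>

definition W11 :: "real \<Rightarrow> (real \<Rightarrow> real) set" where
  "W11 T = {u \<in> extensional {0..T}. absolutely_continuous_fun 0 T u}"

text \<open>
  The supremum is taken in the reals; it is only used for absolutely continuous functions,
  whose variation is finite. For \<open>a = b\<close> the only sums are zero.
\<close>

definition total_variation :: "(real \<Rightarrow> real) \<Rightarrow> real \<Rightarrow> real \<Rightarrow> real" where
  "total_variation u a b =
     Sup {(\<Sum>j<n. \<bar>u (t (Suc j)) - u (t j)\<bar>) | (n::nat) t.
            t 0 = a \<and> t n = b \<and> (\<forall>j<n. t j \<le> t (Suc j))}"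

definition norm_BV0 :: "real \<Rightarrow> (real \<Rightarrow> real) \<Rightarrow> real" where
  "norm_BV0 T u = \<bar>u 0\<bar> + total_variation u 0 T"

definition normal_cone :: "real set \<Rightarrow> real \<Rightarrow> real set" where
  "normal_cone C \<sigma> = {\<nu>. \<forall>z\<in>C. \<nu> * (z - \<sigma>) \<le> 0}"

text \<open>
  The derivatives are the classical ones, which exist almost everywhere and represent the weak
  derivatives because both functions are absolutely continuous.
\<close>

definition stop_solution ::
    "real \<Rightarrow> real \<Rightarrow> real \<Rightarrow> (real \<Rightarrow> real) \<Rightarrow> (real \<Rightarrow> real) \<Rightarrow> bool" where
  "stop_solution T \<alpha> \<beta> \<pi> \<sigma> \<longleftrightarrow>
     \<sigma> \<in> W11 T \<and>
     \<sigma> 0 = closest_point {\<alpha>..\<beta>} (\<pi> 0) \<and>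
     (\<forall>t\<in>{0..T}. \<sigma> t \<in> {\<alpha>..\<beta>}) \<and>
     (AE t in lebesgue_on {0<..<T}. \<exists>p s.
        (\<pi> has_real_derivative p) (at t) \<and> (\<sigma> has_real_derivative s) (at t) \<and>
        p - s \<in> normal_cone {\<alpha>..\<beta>} (\<sigma> t))"

definition stop_op :: "real \<Rightarrow> real \<Rightarrow> real \<Rightarrow> (real \<Rightarrow> real) \<Rightarrow> real \<Rightarrow> real" where
  "stop_op T \<alpha> \<beta> \<pi> = (THE \<sigma>. stop_solution T \<alpha> \<beta> \<pi> \<sigma>)"

definition compl_var :: "real \<Rightarrow> real \<Rightarrow> real \<Rightarrow> (real \<Rightarrow> real) \<Rightarrow> real \<Rightarrow> real" where
  "compl_var T \<alpha> \<beta> \<pi> = (\<lambda>t\<in>{0..T}. \<pi> t - stop_op T \<alpha> \<beta> \<pi> t)"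

definition step_repr ::
    "real \<Rightarrow> nat \<Rightarrow> (nat \<Rightarrow> real) \<Rightarrow> (nat \<Rightarrow> real) \<Rightarrow> (real \<Rightarrow> real) \<Rightarrow> bool" where
  "step_repr T M t v z \<longleftrightarrow>
     t 0 = 0 \<and> t M = T \<and> (\<forall>k<M. t k < t (Suc k)) \<and>
     z \<in> extensional {0..T} \<and>
     (\<forall>k<M. \<forall>s\<in>{t k..<t (Suc k)}. z s = v k) \<and> z T = v M"

definition step_functions :: "real \<Rightarrow> nat \<Rightarrow> (real \<Rightarrow> real) set" where
  "step_functions T N = {z. \<exists>M\<le>N. \<exists>t v. step_repr T M t v z}"

primrec stop_seq :: "real \<Rightarrow> real \<Rightarrow> (nat \<Rightarrow> real) \<Rightarrow> nat \<Rightarrow> real" where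
  "stop_seq \<alpha> \<beta> v 0 = closest_point {\<alpha>..\<beta>} (v 0)"
| "stop_seq \<alpha> \<beta> v (Suc k) = closest_point {\<alpha>..\<beta>} (stop_seq \<alpha> \<beta> v k + v (Suc k) - v k)"

text \<open>
  The result does not depend on the partition representing \<open>z\<close>, so the choice made by
  \<open>SOME\<close> is immaterial for \<open>z \<in> step_functions T N\<close>.
\<close>

definition decoder ::
    "real \<Rightarrow> real \<Rightarrow> real \<Rightarrow> nat \<Rightarrow> (real \<Rightarrow> real) \<Rightarrow> real \<Rightarrow> real" where
  "decoder T \<alpha> \<beta> N z =
     (SOME y. \<exists>M\<le>N. \<exists>t v. step_repr T M t v z \<and> step_repr T M t (stop_seq \<alpha> \<beta> v) y)"

definition encoders :: "real \<Rightarrow> nat \<Rightarrow> ((real \<Rightarrow> real) \<Rightarrow> real \<Rightarrow> real) set" where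
  "encoders T N = W11 T \<rightarrow> step_functions T N"

definition decoded_compl_var ::
    "real \<Rightarrow> real \<Rightarrow> real \<Rightarrow> nat \<Rightarrow> ((real \<Rightarrow> real) \<Rightarrow> real \<Rightarrow> real)
       \<Rightarrow> (real \<Rightarrow> real) \<Rightarrow> real \<Rightarrow> real" where
  "decoded_compl_var T \<alpha> \<beta> N f \<pi> = (\<lambda>t\<in>{0..T}. f \<pi> t - decoder T \<alpha> \<beta> N (f \<pi>) t)"

definition Linf_norm :: "real \<Rightarrow> (real \<Rightarrow> real) \<Rightarrow> ereal" where
  "Linf_norm T u = esssup (lebesgue_on {0<..<T}) (\<lambda>t. ereal \<bar>u t\<bar>)"

text \<open>Errors live in the extended reals since an arbitrary encoder may have infinite error.\<close>

definition encoder_error ::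
    "real \<Rightarrow> real \<Rightarrow> real \<Rightarrow> nat \<Rightarrow> ((real \<Rightarrow> real) \<Rightarrow> real \<Rightarrow> real) \<Rightarrow> ereal" where
  "encoder_error T \<alpha> \<beta> N f =
     (SUP \<pi> \<in> W11 T - {\<lambda>t\<in>{0..T}. 0}.
        Linf_norm T (\<lambda>t. compl_var T \<alpha> \<beta> \<pi> t - decoded_compl_var T \<alpha> \<beta> N f \<pi> t)
          / ereal (norm_BV0 T \<pi>))"

definition minimax_error :: "real \<Rightarrow> real \<Rightarrow> real \<Rightarrow> nat \<Rightarrow> ereal" where
  "minimax_error T \<alpha> \<beta> N = (INF f \<in> encoders T N. encoder_error T \<alpha> \<beta> N f)"

definition equal_var_node :: "real \<Rightarrow> nat \<Rightarrow> (real \<Rightarrow> real) \<Rightarrow> nat \<Rightarrow> real" where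
  "equal_var_node T N \<pi> k =
     (if k < N
      then LEAST t. t \<in> {0..T} \<and>
             total_variation \<pi> 0 t = real k * total_variation \<pi> 0 T / real N
      else T)"

text \<open>
  The sampling points \<open>\<tau> k\<close> need not be unique: the following are the encoders arising from
  any admissible choice of them, for every input separately.
\<close>

definition equal_var_sample :: "real \<Rightarrow> nat \<Rightarrow> (real \<Rightarrow> real) \<Rightarrow> (real \<Rightarrow> real) \<Rightarrow> bool" where
  "equal_var_sample T N \<pi> z \<longleftrightarrow>
     z \<in> extensional {0..T} \<and>
     (if total_variation \<pi> 0 T = 0 then \<forall>t\<in>{0..T}. z t = \<pi> 0
      else (\<exists>\<tau>. \<forall>k\<in>{1..N}.
              \<tau> k \<in> {equal_var_node T N \<pi> (k - 1)..equal_var_node T N \<pi> k} \<and>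
              total_variation \<pi> 0 (\<tau> k)
                = (2 * real k - 1) * total_variation \<pi> 0 T / (2 * real N) \<and>
              (\<forall>t\<in>{equal_var_node T N \<pi> (k - 1)..<equal_var_node T N \<pi> k}. z t = \<pi> (\<tau> k)))
           \<and> z T = \<pi> T)"

definition equal_var_encoder :: "real \<Rightarrow> nat \<Rightarrow> ((real \<Rightarrow> real) \<Rightarrow> real \<Rightarrow> real) \<Rightarrow> bool" where
  "equal_var_encoder T N f \<longleftrightarrow> (\<forall>\<pi>\<in>W11 T. equal_var_sample T N \<pi> (f \<pi>))"

end

theory Submission
  imports Defs
begin

text \<open>
  In terms of the complementary variable \<open>W\<close> both the stop dynamics and the decoder clip the
  current value to the moving interval \<open>[\<pi> - \<beta>, \<pi> - \<alpha>]\<close>. Clipping is non-expansive jointly in the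
  interval and the value, so the error of \<open>W\<close> is at most the uniform distance of \<open>\<pi>\<close> to its
  encoding, and sampling at the midpoints of pieces of equal variation makes this distance at most
  \<open>V / (2 N)\<close>. Conversely \<open>N\<close> constant pieces cannot resolve the climb of \<open>W\<close> on a long ramp better
  than \<open>1 / (2 N)\<close> of its height.

  The stop operator is defined through derivatives almost everywhere. Existence of its solution
  needs Lebesgue's differentiation theorem for absolutely continuous functions, and uniqueness needs
  that such a function is nonincreasing if its derivative is nonpositive almost everywhere.
\<close>

subsection \<open>Lebesgue differentiation\<close>

text \<open>The stop evolution is constructed without time discretisation. On a window where
  \<open>\<pi>\<close> oscillates by at most \<open>\<beta> - \<alpha>\<close> all moving intervals
  have a common point, so clipping once to their intersection has the effect of clipping at every
  instant. This closed form is consistent under splitting a window, hence it can be glued along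
  \<open>{0..T}\<close>; the normal cone condition is then read off at points of differentiability.

  The lower bound rests on one feature of the decoded variable: it is constant on at most
  \<open>N\<close> pieces. If the error is at most \<open>e\<close>, the continuous \<open>W\<close>
  stays within \<open>e\<close> of a constant on each closed piece and climbs by at most
  \<open>2 * e\<close> there; neighbouring pieces share their end point, so
  \<open>W T - W 0 \<le> 2 * N * e\<close>. The ramp must be long because \<open>W\<close> trails
  \<open>\<pi>\<close> by up to \<open>\<beta>\<close>, a fixed loss against a norm that grows.

  In the upper bound \<open>\<pi>\<close> is 1-Lipschitz with respect to its own variation function,
  and sampling at the middle variation level of each piece halves \<open>V / N\<close>. The term for
  \<open>\<pi> 0\<close> in the norm only enlarges the denominator.\<close>

lemma strict_mono_image_Icc:
  fixes f :: "real \<Rightarrow> real"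
  assumes "strict_mono f" "continuous_on UNIV f" "u \<le> v"
  shows "f ` {u..v} = {f u..f v}"
proof
  show "f ` {u..v} \<subseteq> {f u..f v}"
    using assms(1) by (auto simp: strict_mono_less_eq)
  show "{f u..f v} \<subseteq> f ` {u..v}"
  proof
    fix y assume "y \<in> {f u..f v}"
    then obtain x where "u \<le> x" "x \<le> v" "f x = y"
      using IVT'[of f u y v] assms continuous_on_subset[OF assms(2)] by auto
    then show "y \<in> f ` {u..v}" by auto
  qed
qed

text \<open>Vitali's covering theorem is applied on the image side. Images of short intervals around
  points of \<open>E\<close> are closed balls that cover the image of \<open>E\<close> finely, and
  countably many disjoint ones exhaust it up to a null set. The corresponding intervals are
  disjoint, lie in \<open>G\<close> and are at least \<open>1 / p\<close> times as long. Outer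
  measure is used because \<open>E\<close> is an arbitrary set.\<close>

lemma outer_measure_image_le_open:
  fixes f :: "real \<Rightarrow> real"
  assumes mono: "strict_mono f" and cont: "continuous_on UNIV f" and "0 < p"
    and G: "open G" "E \<subseteq> G"
    and slope: "\<And>x d. x \<in> E \<Longrightarrow> 0 < d \<Longrightarrow>
      \<exists>u v. u \<le> x \<and> x \<le> v \<and> u < v \<and> v - u < d \<and> f v - f u \<le> p * (v - u)"
  shows "outer_measure_of lebesgue (f ` E) \<le> ennreal p * emeasure lebesgue G"
proof -
  define K where "K = {(u, v). u < v \<and> {u..v} \<subseteq> G \<and> f v - f u \<le> p * (v - u)}"
  define a where "a = (\<lambda>(u, v). (f u + f v) / 2)"
  define r where "r = (\<lambda>(u, v). (f v - f u) / 2)"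
  have less: "f u < f v" if "u < v" for u v using mono that by (simp add: strict_mono_less)
  have cb: "cball (a (u, v)) (r (u, v)) = {f u..f v}" for u v
    by (auto simp: a_def r_def cball_eq_atLeastAtMost field_simps)
  have r_pos: "0 < r i" if "i \<in> K" for i
    using that less by (auto simp: K_def r_def)
  have cover: "\<exists>i. i \<in> K \<and> y \<in> cball (a i) (r i) \<and> r i < d" if "y \<in> f ` E" "0 < d" for y d
  proof -
    obtain x where x: "x \<in> E" "y = f x" using \<open>y \<in> f ` E\<close> by auto
    obtain e1 where e1: "0 < e1" "cball x e1 \<subseteq> G"
      using G x open_contains_cball by blast
    have "isCont f x" using cont by (simp add: continuous_on_eq_continuous_at)
    then obtain e2 where e2: "0 < e2" "\<And>x'. \<bar>x' - x\<bar> < e2 \<Longrightarrow> \<bar>f x' - f x\<bar> < d"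
      using \<open>0 < d\<close> unfolding continuous_at_eps_delta by (auto simp: dist_real_def)
    obtain u v where uv: "u \<le> x" "x \<le> v" "u < v" "v - u < min e1 e2" "f v - f u \<le> p * (v - u)"
      using slope[OF x(1), of "min e1 e2"] e1 e2 by auto
    have "{u..v} \<subseteq> cball x e1" using uv by (auto simp: dist_real_def)
    then have "(u, v) \<in> K" using uv e1 by (auto simp: K_def)
    moreover have "y \<in> cball (a (u, v)) (r (u, v))"
      unfolding cb using uv x mono by (auto simp: strict_mono_less_eq)
    moreover have "r (u, v) < d"
      using e2(2)[of u] e2(2)[of v] uv by (auto simp: r_def)
    ultimately show ?thesis by blast
  qed
  obtain C where C: "countable C" "C \<subseteq> K"
    "pairwise (\<lambda>i j. disjnt (cball (a i) (r i)) (cball (a j) (r j))) C"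
    "negligible (f ` E - (\<Union>i\<in>C. cball (a i) (r i)))"
    using Vitali_covering_theorem_cballs[of K r "f ` E" a] r_pos cover by blast
  define J where "J = (\<lambda>(u::real, v). {u..v})"
  have Jcb: "f ` J i = cball (a i) (r i)" if "i \<in> K" for i
    using that strict_mono_image_Icc[OF mono cont] by (auto simp: J_def cb K_def split: prod.splits)
  have dis: "disjoint_family_on (\<lambda>i. cball (a i) (r i)) C"
    using C(3) unfolding disjoint_family_on_def pairwise_def disjnt_def by blast
  have disJ: "disjoint_family_on J C"
    unfolding disjoint_family_on_def
  proof (intro ballI impI)
    fix i j assume "i \<in> C" "j \<in> C" "i \<noteq> j"
    then have "f ` J i \<inter> f ` J j = {}"
      using C(2) Jcb dis unfolding disjoint_family_on_def by (metis subsetD)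
    then show "J i \<inter> J j = {}" by auto
  qed
  let ?U = "\<Union>i\<in>C. cball (a i) (r i)"
  have Us: "?U \<in> sets lebesgue"
    using C(1) by (intro sets.countable_UN') auto
  have N: "f ` E - ?U \<in> null_sets lebesgue" using C(4) by (simp add: negligible_iff_null_sets)
  have "outer_measure_of lebesgue (f ` E) \<le> outer_measure_of lebesgue (?U \<union> (f ` E - ?U))"
    by (intro outer_measure_of_mono) auto
  also have "\<dots> = emeasure lebesgue ?U"
    using emeasure_Un_null_set[OF Us N] sets.Un[OF Us null_setsD2[OF N]]
    by (simp only: outer_measure_of_eq)
  also have "\<dots> = (\<integral>\<^sup>+i. emeasure lebesgue (cball (a i) (r i)) \<partial>count_space C)"
    using C(1) dis by (intro emeasure_UN_countable) auto
  also have "\<dots> \<le> (\<integral>\<^sup>+i. ennreal p * emeasure lebesgue (J i) \<partial>count_space C)"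
  proof (intro nn_integral_mono)
    fix i assume "i \<in> space (count_space C)"
    then obtain u v where i: "i = (u, v)" "u < v" "f v - f u \<le> p * (v - u)"
      using C(2) by (auto simp: K_def)
    have "emeasure lebesgue (cball (a i) (r i)) = ennreal (f v - f u)"
      using less[OF i(2)] by (simp add: i(1) cb)
    also have "\<dots> \<le> ennreal (p * (v - u))"
      using i(3) by (rule ennreal_leI)
    also have "\<dots> = ennreal p * emeasure lebesgue (J i)"
      using i(2) \<open>0 < p\<close> by (simp add: i(1) J_def ennreal_mult)
    finally show "emeasure lebesgue (cball (a i) (r i)) \<le> ennreal p * emeasure lebesgue (J i)" .
  qed
  also have "\<dots> = ennreal p * (\<integral>\<^sup>+i. emeasure lebesgue (J i) \<partial>count_space C)"
    by (intro nn_integral_cmult) auto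
  also have "(\<integral>\<^sup>+i. emeasure lebesgue (J i) \<partial>count_space C) = emeasure lebesgue (\<Union>i\<in>C. J i)"
    using C(1) disJ by (intro emeasure_UN_countable[symmetric]) (auto simp: J_def)
  also have "emeasure lebesgue (\<Union>i\<in>C. J i) \<le> emeasure lebesgue G"
    using C(2) G by (intro emeasure_mono) (auto simp: K_def J_def)
  finally show ?thesis by (simp add: mult_left_mono)
qed

text \<open>Regularity in two stages: a measurable hull \<open>B\<close> with the outer measure of
  \<open>E\<close>, then an open \<open>G\<close> exceeding \<open>B\<close> by less than
  \<open>e / p\<close>. The factor \<open>p\<close> turns this surplus into
  \<open>e\<close>.\<close>

lemma outer_measure_image_le:
  fixes f :: "real \<Rightarrow> real"
  assumes mono: "strict_mono f" and cont: "continuous_on UNIV f" and "0 < p"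
    and slope: "\<And>x d. x \<in> E \<Longrightarrow> 0 < d \<Longrightarrow>
      \<exists>u v. u \<le> x \<and> x \<le> v \<and> u < v \<and> v - u < d \<and> f v - f u \<le> p * (v - u)"
  shows "outer_measure_of lebesgue (f ` E) \<le> ennreal p * outer_measure_of lebesgue E"
proof (rule ennreal_le_epsilon)
  fix e :: real assume "0 < e"
  obtain B where B: "B \<in> sets lebesgue" "E \<subseteq> B" "outer_measure_of lebesgue E = emeasure lebesgue B"
    using outer_measure_of_attain[of E lebesgue] by auto
  obtain G where G: "open G" "B \<subseteq> G" "emeasure lebesgue (G - B) < ennreal (e / p)"
    using sets_lebesgue_outer_open[OF B(1) divide_pos_pos[OF \<open>0 < e\<close> \<open>0 < p\<close>]] by metis
  have "emeasure lebesgue G = emeasure lebesgue B + emeasure lebesgue (G - B)"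
    using G(1,2) B(1) plus_emeasure[of B lebesgue "G - B"] sets.Diff[of G lebesgue B]
    by (metis Diff_disjoint Diff_partition borel_open sets_completionI_sets sets_lborel)
  also have "\<dots> \<le> emeasure lebesgue B + ennreal (e / p)"
    using G by (intro add_left_mono) auto
  finally have "ennreal p * emeasure lebesgue G
      \<le> ennreal p * (emeasure lebesgue B + ennreal (e / p))"
    by (rule mult_left_mono) simp
  also have "\<dots> = ennreal p * emeasure lebesgue B + ennreal p * ennreal (e / p)"
    by (rule distrib_left)
  also have "ennreal p * ennreal (e / p) = ennreal e"
    using \<open>0 < e\<close> \<open>0 < p\<close> by (subst ennreal_mult[symmetric]) auto
  finally have "ennreal p * emeasure lebesgue G \<le> ennreal p * outer_measure_of lebesgue E + ennreal e"
    by (simp only: B(3))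
  moreover have "outer_measure_of lebesgue (f ` E) \<le> ennreal p * emeasure lebesgue G"
    using B(2) G(2) by (intro outer_measure_image_le_open[OF mono cont \<open>0 < p\<close> G(1) _ slope]) auto
  ultimately show "outer_measure_of lebesgue (f ` E)
      \<le> ennreal p * outer_measure_of lebesgue E + ennreal e"
    by (rule order_trans[rotated])
qed

text \<open>Slopes at least \<open>q\<close> of \<open>f\<close> are slopes at most
  \<open>1 / q\<close> of the inverse function, so the previous estimate is applied to
  \<open>inv f\<close>. Surjectivity makes this inverse strictly increasing and continuous on the
  whole line.\<close>

lemma outer_measure_le_image:
  fixes f :: "real \<Rightarrow> real"
  assumes mono: "strict_mono f" and cont: "continuous_on UNIV f" and surj: "surj f" and "0 < q"
    and slope: "\<And>x d. x \<in> E \<Longrightarrow> 0 < d \<Longrightarrow>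
      \<exists>u v. u \<le> x \<and> x \<le> v \<and> u < v \<and> v - u < d \<and> q * (v - u) \<le> f v - f u"
  shows "outer_measure_of lebesgue E \<le> ennreal (1 / q) * outer_measure_of lebesgue (f ` E)"
proof -
  have "inj f" using mono strict_mono_imp_inj_on by blast
  define g where "g = inv f"
  have gf: "g (f x) = x" for x using \<open>inj f\<close> by (simp add: g_def)
  have fg: "f (g y) = y" for y using surj by (simp add: g_def surj_f_inv_f)
  have gmono: "strict_mono g"
    by (metis fg mono strict_monoI strict_mono_less)
  have gcont: "continuous_on UNIV g"
  proof (rule continuous_onI_mono)
    show "open (range g)" by (metis gf open_UNIV surjI)
  qed (use gmono in \<open>auto simp: strict_mono_less_eq\<close>)
  have "outer_measure_of lebesgue (g ` f ` E) \<le> ennreal (1 / q) * outer_measure_of lebesgue (f ` E)"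
  proof (rule outer_measure_image_le[OF gmono gcont])
    fix y d :: real assume "y \<in> f ` E" "0 < d"
    then obtain x where x: "x \<in> E" "y = f x" by auto
    have "isCont f x" using cont by (simp add: continuous_on_eq_continuous_at)
    then obtain e where e: "0 < e" "\<And>x'. \<bar>x' - x\<bar> < e \<Longrightarrow> \<bar>f x' - f x\<bar> < d / 2"
      using \<open>0 < d\<close> unfolding continuous_at_eps_delta dist_real_def by (meson half_gt_zero)
    obtain u v where uv: "u \<le> x" "x \<le> v" "u < v" "v - u < e" "q * (v - u) \<le> f v - f u"
      using slope[OF x(1) e(1)] by auto
    have "\<bar>f u - f x\<bar> < d / 2" "\<bar>f v - f x\<bar> < d / 2"
      using uv e(2)[of u] e(2)[of v] by linarith+
    then have "f v - f u < d" by linarith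
    then show "\<exists>u v. u \<le> y \<and> y \<le> v \<and> u < v \<and> v - u < d \<and> g v - g u \<le> 1 / q * (v - u)"
      using uv x mono \<open>0 < q\<close>
      by (intro exI[of _ "f u"] exI[of _ "f v"])
        (auto simp: gf strict_mono_less strict_mono_less_eq field_simps)
  qed (use \<open>0 < q\<close> in auto)
  then show ?thesis by (simp add: image_image gf)
qed

lemma negligible_outer_measure_zero:
  fixes E :: "'a::euclidean_space set"
  assumes "outer_measure_of lebesgue E = 0"
  shows "negligible E"
proof -
  obtain B where "B \<in> sets lebesgue" "E \<subseteq> B" "outer_measure_of lebesgue E = emeasure lebesgue B"
    using outer_measure_of_attain[of E lebesgue] by auto
  then show ?thesis
    using assms by (metis negligible_iff_emeasure0 negligible_subset)
qed

lemma negligible_UN_countable: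
  assumes "countable I" "\<And>i. i \<in> I \<Longrightarrow> negligible (X i)"
  shows "negligible (\<Union>i\<in>I. X i)"
  using assms by (intro negligible_countable_Union) auto

text \<open>Lebesgue's theorem: where the intervals around a point have slopes accumulating at two different
  values or at infinity, comparing the outer measures of the set and of its image forces the set
  to be null.\<close>

lemma strict_mono_differentiable_ae:
  fixes f :: "real \<Rightarrow> real"
  assumes mono: "strict_mono f" and cont: "continuous_on UNIV f" and surj: "surj f"
  shows "negligible {x. \<not> (\<exists>D. (f has_real_derivative D) (at x))}"
proof -
  \<comment> \<open>Both predicates use intervals that contain \<open>x\<close> anywhere. This suits
    the covering argument, and intervals with end point \<open>x\<close> give the difference
    quotients.\<close>
  define lo where "lo p x \<longleftrightarrow>
    (\<forall>d>0. \<exists>u v. u \<le> x \<and> x \<le> v \<and> u < v \<and> v - u < d \<and> f v - f u \<le> p * (v - u))" for p x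
  define hi where "hi q x \<longleftrightarrow>
    (\<forall>d>0. \<exists>u v. u \<le> x \<and> x \<le> v \<and> u < v \<and> v - u < d \<and> q * (v - u) \<le> f v - f u)" for q x
  \<comment> \<open>Truncation to a bounded interval makes the outer measure a real number
    \<open>r\<close>, so that \<open>r \<le> p / q * r\<close> with \<open>p < q\<close> forces
    \<open>r = 0\<close>.\<close>
  define N1 where "N1 m p q = {x. x \<in> {- real m..real m} \<and> lo p x \<and> hi q x}" for m :: nat and p q
  define N2 where "N2 m = {x. x \<in> {- real m..real m} \<and> (\<forall>n. hi (real (Suc n)) x)}" for m :: nat
  have fin: "\<exists>r\<ge>0. outer_measure_of lebesgue E = ennreal r" if "E \<subseteq> {- real m..real m}" for E m
  proof -
    have "outer_measure_of lebesgue E \<le> ennreal (2 * real m)"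
      using outer_measure_of_mono[OF that, of lebesgue] by simp
    then show ?thesis
      by (metis ennreal_cases ennreal_neq_top neq_top_trans)
  qed
  have N1_sub: "N1 m p q \<subseteq> {- real m..real m}" and N2_sub: "N2 m \<subseteq> {- real m..real m}" for m p q
    by (auto simp: N1_def N2_def)
  have n1: "negligible (N1 m p q)" if "0 < p" "p < q" for m p q
  proof (rule negligible_outer_measure_zero)
    let ?E = "N1 m p q"
    obtain r where r: "0 \<le> r" "outer_measure_of lebesgue ?E = ennreal r"
      using fin[of ?E m] N1_sub by blast
    have q: "0 < q" using that by simp
    have "outer_measure_of lebesgue ?E \<le> ennreal (1 / q) * outer_measure_of lebesgue (f ` ?E)"
      by (intro outer_measure_le_image[OF mono cont surj q]) (auto simp: N1_def hi_def)
    also have "\<dots> \<le> ennreal (1 / q) * (ennreal p * outer_measure_of lebesgue ?E)"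
      by (intro mult_left_mono outer_measure_image_le[OF mono cont \<open>0 < p\<close>]) (auto simp: N1_def lo_def)
    also have "\<dots> = ennreal (p / q * r)"
      using that r q by (simp add: r(2) ennreal_mult[symmetric])
    finally have "r \<le> p / q * r"
      using r that by (simp add: r(2))
    then have "r * (q - p) \<le> 0" using q by (simp add: field_simps)
    then have "r = 0" using that r(1) by (simp add: mult_le_0_iff)
    then show "outer_measure_of lebesgue ?E = 0" using r by simp
  qed
  have n2: "negligible (N2 m)" for m
  proof (rule negligible_outer_measure_zero)
    let ?E = "N2 m"
    obtain r where r: "0 \<le> r" "outer_measure_of lebesgue ?E = ennreal r"
      using fin[of ?E m] N2_sub by blast
    define L where "L = f (real m) - f (- real m)"
    have L: "0 \<le> L" using mono by (simp add: L_def strict_mono_less_eq)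
    have "f ` ?E \<subseteq> {f (- real m)..f (real m)}"
      using mono by (auto simp: N2_def strict_mono_less_eq)
    from outer_measure_of_mono[OF this, of lebesgue]
    have img: "outer_measure_of lebesgue (f ` ?E) \<le> ennreal L"
      using L by (simp add: L_def)
    \<comment> \<open>Around points of \<open>N2 m\<close> there are arbitrarily short intervals of
      slope at least \<open>Suc n\<close>, for every \<open>n\<close>, while the image has length at
      most \<open>L\<close>.\<close>
    have "r \<le> L / real (Suc n)" for n
    proof -
      have "outer_measure_of lebesgue ?E
          \<le> ennreal (1 / real (Suc n)) * outer_measure_of lebesgue (f ` ?E)"
        by (intro outer_measure_le_image[OF mono cont surj]) (auto simp: N2_def hi_def)
      also have "\<dots> \<le> ennreal (1 / real (Suc n)) * ennreal L"
        by (intro mult_left_mono img) simp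
      also have "\<dots> = ennreal (L / real (Suc n))"
        using L by (simp add: ennreal_mult[symmetric])
      finally show ?thesis
        using r L by (simp add: r(2))
    qed
    moreover have "(\<lambda>n. L / real (Suc n)) \<longlonglongrightarrow> 0"
      by (rule LIMSEQ_Suc[OF lim_const_over_n])
    ultimately have "r \<le> 0"
      by (intro LIMSEQ_le_const[of _ 0 r]) auto
    then show "outer_measure_of lebesgue ?E = 0" using r by simp
  qed
  define N where "N = (\<Union>m. N2 m) \<union> (\<Union>m. \<Union>p\<in>\<rat>. \<Union>q\<in>\<rat>. if 0 < p \<and> p < q then N1 m p q else {})"
  have "negligible N"
    unfolding N_def
    by (intro negligible_Un negligible_UN_countable countable_rat countableI_type n2) (simp add: n1)
  moreover have "{x. \<not> (\<exists>D. (f has_real_derivative D) (at x))} \<subseteq> N"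
  proof (rule ccontr)
    assume "\<not> ?thesis"
    then obtain x where nd: "\<And>D. \<not> (f has_real_derivative D) (at x)" and x: "x \<notin> N" by blast
    obtain m where "\<bar>x\<bar> \<le> real m"
      using real_arch_simple by blast
    then have m: "x \<in> {- real m..real m}"
      by (simp add: abs_le_iff)
    have "x \<notin> N2 m" using x by (auto simp: N_def)
    then obtain n0 where n0: "\<not> hi (real (Suc n0)) x" using m by (auto simp: N2_def)
    have nlo: "\<not> lo p x" if "p \<in> \<rat>" "q \<in> \<rat>" "0 < p" "p < q" "hi q x" for p q
      using x that m by (force simp: N_def N1_def)
    \<comment> \<open>\<open>S\<close> collects the positive strict upper bounds for the slopes of
      all sufficiently short intervals around \<open>x\<close>. Its infimum \<open>c\<close> is the
      upper derivative, the candidate for the derivative.\<close>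
    define S where "S = {q. 0 < q \<and> \<not> hi q x}"
    define c where "c = Inf S"
    have S: "S \<noteq> {}" "bdd_below S"
      using n0 by (auto simp: S_def intro!: exI[of _ "real (Suc n0)"] bdd_belowI[of _ 0])
    have upper: "\<exists>d>0. \<forall>u v. u \<le> x \<longrightarrow> x \<le> v \<longrightarrow> u < v \<longrightarrow> v - u < d \<longrightarrow> f v - f u < (c + e) * (v - u)"
      if e: "0 < e" for e
    proof -
      obtain q where q: "q \<in> S" "q < c + e"
        using cInf_lessD[OF S(1), of "c + e"] e by (auto simp: c_def)
      then obtain d where d: "d > 0" "\<And>u v. u \<le> x \<Longrightarrow> x \<le> v \<Longrightarrow> u < v \<Longrightarrow> v - u < d \<Longrightarrow> f v - f u < q * (v - u)"
        by (auto simp: S_def hi_def not_le) (meson not_le)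
      have "f v - f u < (c + e) * (v - u)" if "u \<le> x" "x \<le> v" "u < v" "v - u < d" for u v
        using less_trans[OF _ d(2)[OF that]] less_trans[OF d(2)[OF that]]
          mult_strict_right_mono[OF q(2), of "v - u"] \<open>u < v\<close> by simp
      then show ?thesis using d(1) by blast
    qed
    have lower: "\<exists>d>0. \<forall>u v. u \<le> x \<longrightarrow> x \<le> v \<longrightarrow> u < v \<longrightarrow> v - u < d \<longrightarrow> (c - e) * (v - u) < f v - f u"
      if e: "0 < e" for e
    proof (cases "c - e \<le> 0")
      case True
      have "(c - e) * (v - u) < f v - f u" if "u < v" for u v
      proof -
        have "(c - e) * (v - u) \<le> 0" using True that by (simp add: mult_le_0_iff)
        moreover have "f u < f v" using mono that by (simp add: strict_mono_less)
        ultimately show ?thesis by simp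
      qed
      then show ?thesis by (intro exI[of _ 1]) auto
    next
      case False
      \<comment> \<open>Two rationals \<open>p < q\<close> fit between \<open>c - e\<close> and
        \<open>c\<close>. Slopes at least \<open>q\<close> recur at all scales because
        \<open>q\<close> is below the infimum; since \<open>x\<close> avoids \<open>N1\<close>,
        slopes at most \<open>p\<close> cannot recur as well.\<close>
      obtain p where p: "p \<in> \<rat>" "c - e < p" "p < c" using Rats_dense_in_real[of "c - e" c] e by auto
      obtain q where q: "q \<in> \<rat>" "p < q" "q < c" using Rats_dense_in_real[of p c] p by auto
      have "q \<notin> S" using q(3) cInf_lower[OF _ S(2)] unfolding c_def by force
      then have "hi q x" using False p q by (auto simp: S_def)
      then have "\<not> lo p x" using nlo[OF p(1) q(1)] False p q by auto
      then obtain d where d: "d > 0" "\<And>u v. u \<le> x \<Longrightarrow> x \<le> v \<Longrightarrow> u < v \<Longrightarrow> v - u < d \<Longrightarrow> p * (v - u) < f v - f u"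
        unfolding lo_def by (meson not_le)
      have "(c - e) * (v - u) < f v - f u" if "u \<le> x" "x \<le> v" "u < v" "v - u < d" for u v
        using less_trans[OF _ d(2)[OF that]] less_trans[OF d(2)[OF that]]
          mult_strict_right_mono[OF p(2), of "v - u"] \<open>u < v\<close> by simp
      then show ?thesis using d(1) by blast
    qed
    have "(\<lambda>h. (f (x + h) - f x) / h) \<midarrow>0\<rightarrow> c"
    proof (rule LIM_I)
      fix e :: real assume "0 < e"
      obtain d1 where d1: "d1 > 0" "\<And>u v. u \<le> x \<Longrightarrow> x \<le> v \<Longrightarrow> u < v \<Longrightarrow> v - u < d1 \<Longrightarrow> f v - f u < (c + e) * (v - u)"
        using upper[OF \<open>0 < e\<close>] by blast
      obtain d2 where d2: "d2 > 0" "\<And>u v. u \<le> x \<Longrightarrow> x \<le> v \<Longrightarrow> u < v \<Longrightarrow> v - u < d2 \<Longrightarrow> (c - e) * (v - u) < f v - f u"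
        using lower[OF \<open>0 < e\<close>] by blast
      have "norm ((f (x + h) - f x) / h - c) < e" if h: "h \<noteq> 0" "norm (h - 0) < min d1 d2" for h
      proof (cases "h > 0")
        case True
        then have "f (x + h) - f x < (c + e) * h" "(c - e) * h < f (x + h) - f x"
          using d1(2)[of x "x + h"] d2(2)[of x "x + h"] h by auto
        with True show ?thesis by (auto simp: abs_less_iff field_simps)
      next
        case False
        then have "f x - f (x + h) < (c + e) * - h" "(c - e) * - h < f x - f (x + h)"
          using d1(2)[of "x + h" x] d2(2)[of "x + h" x] h by auto
        with False h show ?thesis by (auto simp: abs_less_iff field_simps)
      qed
      then show "\<exists>s>0. \<forall>h. h \<noteq> 0 \<and> norm (h - 0) < s \<longrightarrow> norm ((f (x + h) - f x) / h - c) < e"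
        using d1(1) d2(1) by (intro exI[of _ "min d1 d2"]) auto
    qed
    then show False using nd by (simp add: DERIV_def)
  qed
  ultimately show ?thesis by (rule negligible_subset)
qed

subsection \<open>Total variation\<close>

definition partition_sums :: "(real \<Rightarrow> real) \<Rightarrow> real \<Rightarrow> real \<Rightarrow> real set" where
  "partition_sums u a b =
     {(\<Sum>j<n. \<bar>u (t (Suc j)) - u (t j)\<bar>) | (n::nat) t.
        t 0 = a \<and> t n = b \<and> (\<forall>j<n. t j \<le> t (Suc j))}"

lemma total_variation_alt: "total_variation u a b = Sup (partition_sums u a b)"
  by (simp add: total_variation_def partition_sums_def)

lemma partition_mono:
  fixes t :: "nat \<Rightarrow> real"
  assumes "\<forall>j<n. t j \<le> t (Suc j)" "i \<le> k" "k \<le> n"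
  shows "t i \<le> t k"
  using assms(2,3)
proof (induction k)
  case (Suc k)
  then show ?case using assms(1) by (cases "i = Suc k") (auto intro: order_trans)
qed simp

text \<open>Truncating the nodes by \<open>min\<close> and \<open>max\<close> at \<open>b\<close>
  gives partitions of both halves with the same number of nodes, repeated nodes contributing zero.
  The triangle inequality is used only on an interval straddling \<open>b\<close>.\<close>

lemma partition_sums_split:
  assumes "a \<le> b" "b \<le> c" "s \<in> partition_sums u a c"
  obtains s1 s2 where "s1 \<in> partition_sums u a b" "s2 \<in> partition_sums u b c" "s \<le> s1 + s2"
proof -
  obtain n t where t: "s = (\<Sum>j<n. \<bar>u (t (Suc j)) - u (t j)\<bar>)"
    "t 0 = a" "t n = c" "\<forall>j<n. t j \<le> t (Suc j)"
    using assms(3) by (auto simp: partition_sums_def)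
  define t1 where "t1 j = min (t j) b" for j
  define t2 where "t2 j = max (t j) b" for j
  have "\<bar>u (t (Suc j)) - u (t j)\<bar>
      \<le> \<bar>u (t1 (Suc j)) - u (t1 j)\<bar> + \<bar>u (t2 (Suc j)) - u (t2 j)\<bar>" if "j < n" for j
    using t(4) that by (auto simp: t1_def t2_def min_def max_def)
  then have "s \<le> (\<Sum>j<n. \<bar>u (t1 (Suc j)) - u (t1 j)\<bar> + \<bar>u (t2 (Suc j)) - u (t2 j)\<bar>)"
    unfolding t(1) by (intro sum_mono) auto
  then have "s \<le> (\<Sum>j<n. \<bar>u (t1 (Suc j)) - u (t1 j)\<bar>) + (\<Sum>j<n. \<bar>u (t2 (Suc j)) - u (t2 j)\<bar>)"
    by (simp add: sum.distrib)
  moreover have "(\<Sum>j<n. \<bar>u (t1 (Suc j)) - u (t1 j)\<bar>) \<in> partition_sums u a b"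
    unfolding partition_sums_def using t assms(1,2)
    by (intro CollectI exI[of _ n] exI[of _ t1]) (auto simp: t1_def intro: min.mono)
  moreover have "(\<Sum>j<n. \<bar>u (t2 (Suc j)) - u (t2 j)\<bar>) \<in> partition_sums u b c"
    unfolding partition_sums_def using t assms(1,2)
    by (intro CollectI exI[of _ n] exI[of _ t2]) (auto simp: t2_def intro: max.mono)
  ultimately show thesis using that by blast
qed

lemma partition_sums_append:
  assumes "s1 \<in> partition_sums u a b" "s2 \<in> partition_sums u b c"
  shows "s1 + s2 \<in> partition_sums u a c"
proof -
  obtain n t where t: "s1 = (\<Sum>j<n. \<bar>u (t (Suc j)) - u (t j)\<bar>)"
    "t 0 = a" "t n = b" "\<forall>j<n. t j \<le> t (Suc j)"
    using assms(1) by (auto simp: partition_sums_def)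
  obtain m r where r: "s2 = (\<Sum>j<m. \<bar>u (r (Suc j)) - u (r j)\<bar>)"
    "r 0 = b" "r m = c" "\<forall>j<m. r j \<le> r (Suc j)"
    using assms(2) by (auto simp: partition_sums_def)
  define q where "q j = (if j \<le> n then t j else r (j - n))" for j
  have q1: "q j = t j" if "j \<le> n" for j using that by (simp add: q_def)
  have q2: "q (n + j) = r j" for j using t r by (cases j) (auto simp: q_def)
  have "(\<Sum>j<n + m. \<bar>u (q (Suc j)) - u (q j)\<bar>)
      = (\<Sum>j<n. \<bar>u (q (Suc j)) - u (q j)\<bar>) + (\<Sum>j<m. \<bar>u (q (n + Suc j)) - u (q (n + j))\<bar>)"
    by (induction m) auto
  also have "\<dots> = s1 + s2"
    unfolding q2 t(1) r(1) by (intro arg_cong2[of _ _ _ _ "(+)"] sum.cong) (auto simp: q1)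
  finally have "(\<Sum>j<n + m. \<bar>u (q (Suc j)) - u (q j)\<bar>) = s1 + s2" .
  moreover have "q j \<le> q (Suc j)" if j: "j < n + m" for j
  proof (cases "j < n")
    case True
    then show ?thesis using t by (simp add: q1)
  next
    case False
    then obtain i where "j = n + i" "i < m"
      using j by (metis add_less_cancel_left le_Suc_ex not_le)
    then show ?thesis using r q2[of i] q2[of "Suc i"] by simp
  qed
  moreover have "q 0 = a" "q (n + m) = c" using q1[of 0] q2[of m] t r by auto
  ultimately show ?thesis
    unfolding partition_sums_def by (intro CollectI exI[of _ "n + m"] exI[of _ q]) auto
qed

lemma abs_diff_in_partition_sums:
  assumes "a \<le> b"
  shows "\<bar>u b - u a\<bar> \<in> partition_sums u a b"
  unfolding partition_sums_def using assms
  by (intro CollectI exI[of _ 1] exI[of _ "\<lambda>j. if j = 0 then a else b"]) auto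

lemma partition_sums_singleton: "partition_sums u a a = {0}"
proof -
  have "s = 0" if "s \<in> partition_sums u a a" for s
  proof -
    obtain n t where t: "s = (\<Sum>j<n. \<bar>u (t (Suc j)) - u (t j)\<bar>)"
      "t 0 = a" "t n = a" "\<forall>j<n. t j \<le> t (Suc j)"
      using \<open>s \<in> _\<close> by (auto simp: partition_sums_def)
    have "t j = a" if "j \<le> n" for j
      using partition_mono[OF t(4), of 0 j] partition_mono[OF t(4), of j n] that t(2,3) by auto
    then show ?thesis using t(1) by (auto intro!: sum.neutral)
  qed
  moreover have "0 \<in> partition_sums u a a" using abs_diff_in_partition_sums[of a a u] by simp
  ultimately show ?thesis by blast
qed

text \<open>Guards the real-valued \<open>Sup\<close> in \<open>total_variation\<close>, which
  dominates the partition sums only when these are bounded.\<close>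

definition bounded_variation :: "(real \<Rightarrow> real) \<Rightarrow> real \<Rightarrow> real \<Rightarrow> bool" where
  "bounded_variation u a b \<longleftrightarrow> bdd_above (partition_sums u a b)"

lemma bounded_variation_join:
  assumes "a \<le> b" "b \<le> c" "bounded_variation u a b" "bounded_variation u b c"
  shows "bounded_variation u a c"
proof -
  obtain M1 M2 where "\<And>s. s \<in> partition_sums u a b \<Longrightarrow> s \<le> M1" "\<And>s. s \<in> partition_sums u b c \<Longrightarrow> s \<le> M2"
    using assms(3,4) by (auto simp: bounded_variation_def bdd_above_def)
  then have "s \<le> M1 + M2" if s: "s \<in> partition_sums u a c" for s
    using partition_sums_split[OF assms(1,2) s] by (smt (verit))
  then show ?thesis by (auto simp: bounded_variation_def bdd_above_def)
qed

lemma bounded_variation_subinterval: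
  assumes "bounded_variation u a b" "a \<le> c" "c \<le> d" "d \<le> b"
  shows "bounded_variation u c d"
proof -
  obtain M where M: "\<And>s. s \<in> partition_sums u a b \<Longrightarrow> s \<le> M"
    using assms(1) by (auto simp: bounded_variation_def bdd_above_def)
  have "s \<le> M" if "s \<in> partition_sums u c d" for s
    using M[OF partition_sums_append[OF partition_sums_append[OF
          abs_diff_in_partition_sums[OF assms(2)] that] abs_diff_in_partition_sums[OF assms(4)]]]
    by linarith
  then show ?thesis by (auto simp: bounded_variation_def bdd_above_def)
qed

lemma partition_sum_le_total_variation:
  "bounded_variation u a b \<Longrightarrow> s \<in> partition_sums u a b \<Longrightarrow> s \<le> total_variation u a b"
  by (simp add: total_variation_alt bounded_variation_def cSup_upper)

lemma total_variation_le:
  assumes "a \<le> b" "\<And>s. s \<in> partition_sums u a b \<Longrightarrow> s \<le> M"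
  shows "total_variation u a b \<le> M"
  unfolding total_variation_alt using assms abs_diff_in_partition_sums[of a b u]
  by (intro cSup_least) auto

lemma abs_diff_le_total_variation:
  "bounded_variation u a b \<Longrightarrow> a \<le> b \<Longrightarrow> \<bar>u b - u a\<bar> \<le> total_variation u a b"
  by (intro partition_sum_le_total_variation abs_diff_in_partition_sums)

lemma total_variation_refl [simp]: "total_variation u a a = 0"
  by (simp add: total_variation_alt partition_sums_singleton)

lemma total_variation_add:
  assumes "bounded_variation u a c" "a \<le> b" "b \<le> c"
  shows "total_variation u a c = total_variation u a b + total_variation u b c"
proof (rule antisym)
  have bv: "bounded_variation u a b" "bounded_variation u b c"
    using assms by (auto intro: bounded_variation_subinterval[OF assms(1)])
  show "total_variation u a c \<le> total_variation u a b + total_variation u b c"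
  proof (rule total_variation_le)
    fix s assume "s \<in> partition_sums u a c"
    then obtain s1 s2 where "s1 \<in> partition_sums u a b" "s2 \<in> partition_sums u b c" "s \<le> s1 + s2"
      using partition_sums_split assms(2,3) by metis
    then show "s \<le> total_variation u a b + total_variation u b c"
      using bv by (meson add_mono order_trans partition_sum_le_total_variation)
  qed (use assms in auto)
  have sum_le: "s1 + s2 \<le> total_variation u a c"
    if "s1 \<in> partition_sums u a b" "s2 \<in> partition_sums u b c" for s1 s2
    using partition_sum_le_total_variation[OF assms(1) partition_sums_append[OF that]] .
  \<comment> \<open>The two suprema are taken one after the other: \<open>s1\<close> is fixed while
    the sums over \<open>{b..c}\<close> vary.\<close>
  have "total_variation u b c \<le> total_variation u a c - s1"
    if s1: "s1 \<in> partition_sums u a b" for s1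
  proof (rule total_variation_le)
    show "s \<le> total_variation u a c - s1" if "s \<in> partition_sums u b c" for s
      using sum_le[OF s1 that] by simp
  qed (use assms in auto)
  then have "s1 \<le> total_variation u a c - total_variation u b c"
    if "s1 \<in> partition_sums u a b" for s1
    using that by force
  then have "total_variation u a b \<le> total_variation u a c - total_variation u b c"
    using assms(2) by (intro total_variation_le) auto
  then show "total_variation u a b + total_variation u b c \<le> total_variation u a c" by simp
qed

lemma total_variation_nonneg:
  "bounded_variation u a b \<Longrightarrow> a \<le> b \<Longrightarrow> 0 \<le> total_variation u a b"
  using abs_diff_le_total_variation[of u a b] by linarith

subsection \<open>Absolutely continuous functions\<close>

lemma absolutely_continuous_fun_subinterval:
  assumes "absolutely_continuous_fun a b u" "a \<le> c" "d \<le> b"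
  shows "absolutely_continuous_fun c d u"
  unfolding absolutely_continuous_fun_def
proof (intro allI impI)
  fix e :: real assume "0 < e"
  then obtain \<delta> where "0 < \<delta>" and \<delta>: "\<And>(n::nat) (x::nat \<Rightarrow> real) y.
      (\<forall>i<n. a \<le> x i \<and> x i \<le> y i \<and> y i \<le> b) \<and> disjoint_family_on (\<lambda>i. {x i<..<y i}) {..<n} \<and>
      (\<Sum>i<n. y i - x i) < \<delta> \<longrightarrow> (\<Sum>i<n. \<bar>u (y i) - u (x i)\<bar>) < e"
    using assms(1) unfolding absolutely_continuous_fun_def by blast
  have "(\<Sum>i<n. \<bar>u (y i) - u (x i)\<bar>) < e"
    if "(\<forall>i<n. c \<le> x i \<and> x i \<le> y i \<and> y i \<le> d) \<and> disjoint_family_on (\<lambda>i. {x i<..<y i}) {..<n} \<and>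
      (\<Sum>i<n. y i - x i) < \<delta>" for n :: nat and x y :: "nat \<Rightarrow> real"
    using that \<delta>[of n x y] assms(2,3) by (meson order_trans)
  then show "\<exists>\<delta>>0. \<forall>(n::nat) x y.
      (\<forall>i<n. c \<le> x i \<and> x i \<le> y i \<and> y i \<le> d) \<and> disjoint_family_on (\<lambda>i. {x i<..<y i}) {..<n} \<and>
      (\<Sum>i<n. y i - x i) < \<delta> \<longrightarrow> (\<Sum>i<n. \<bar>u (y i) - u (x i)\<bar>) < e"
    using \<open>0 < \<delta>\<close> by blast
qed

text \<open>The definition numbers the intervals by initial segments of the naturals. Tagged
  divisions index them by pairs of a tag and an interval, so the condition is transferred along a
  bijection to any finite index set.\<close>

lemma absolutely_continuous_fun_finite:
  assumes "absolutely_continuous_fun a b u" "0 < e"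
  shows "\<exists>\<delta>>0. \<forall>(I::'i set) x y. finite I \<longrightarrow>
      (\<forall>i\<in>I. a \<le> x i \<and> x i \<le> y i \<and> y i \<le> b) \<longrightarrow>
      disjoint_family_on (\<lambda>i. {x i<..<y i}) I \<longrightarrow> (\<Sum>i\<in>I. y i - x i) < \<delta> \<longrightarrow>
      (\<Sum>i\<in>I. \<bar>u (y i) - u (x i)\<bar>) < e"
proof -
  obtain \<delta> where "0 < \<delta>" and \<delta>: "\<And>(n::nat) (x::nat \<Rightarrow> real) y.
      (\<forall>i<n. a \<le> x i \<and> x i \<le> y i \<and> y i \<le> b) \<Longrightarrow> disjoint_family_on (\<lambda>i. {x i<..<y i}) {..<n} \<Longrightarrow>
      (\<Sum>i<n. y i - x i) < \<delta> \<Longrightarrow> (\<Sum>i<n. \<bar>u (y i) - u (x i)\<bar>) < e"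
    using assms unfolding absolutely_continuous_fun_def by meson
  show ?thesis
  proof (intro exI[of _ \<delta>] conjI allI impI)
    fix I :: "'i set" and x y
    assume "finite I" and xy: "\<forall>i\<in>I. a \<le> x i \<and> x i \<le> y i \<and> y i \<le> b"
      and dis: "disjoint_family_on (\<lambda>i. {x i<..<y i}) I" and len: "(\<Sum>i\<in>I. y i - x i) < \<delta>"
    obtain h where h: "bij_betw h {..<card I} I"
      using ex_bij_betw_nat_finite[OF \<open>finite I\<close>] by (auto simp: lessThan_atLeast0)
    have hI: "h i \<in> I" if "i < card I" for i using h that by (auto simp: bij_betw_def)
    have re: "(\<Sum>i<card I. g (h i)) = (\<Sum>i\<in>I. g i)" for g :: "'i \<Rightarrow> real"
      using sum.reindex_bij_betw[OF h] .
    have "disjoint_family_on (\<lambda>i. {x (h i)<..<y (h i)}) {..<card I}"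
      unfolding disjoint_family_on_def
    proof (intro ballI impI)
      fix i j assume ij: "i \<in> {..<card I}" "j \<in> {..<card I}" "i \<noteq> j"
      then have "h i \<noteq> h j" using h by (auto simp: bij_betw_def inj_on_def)
      then show "{x (h i)<..<y (h i)} \<inter> {x (h j)<..<y (h j)} = {}"
        using dis hI ij unfolding disjoint_family_on_def by blast
    qed
    then show "(\<Sum>i\<in>I. \<bar>u (y i) - u (x i)\<bar>) < e"
      using \<delta>[of "card I" "\<lambda>i. x (h i)" "\<lambda>i. y (h i)"] re[of "\<lambda>i. y i - x i"]
        re[of "\<lambda>i. \<bar>u (y i) - u (x i)\<bar>"] xy hI len by auto
  qed (rule \<open>0 < \<delta>\<close>)
qed

text \<open>The intervals of any partition of \<open>{c..d}\<close> are disjoint with total length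
  \<open>d - c\<close>, so one \<open>\<delta>\<close> controls all partition sums at once.
  Finiteness and continuity of the variation both follow from this.\<close>

lemma absolutely_continuous_fun_partition_sums:
  assumes "absolutely_continuous_fun a b u" "0 < e"
  obtains \<delta> where "0 < \<delta>"
    "\<And>c d s. a \<le> c \<Longrightarrow> d \<le> b \<Longrightarrow> d - c < \<delta> \<Longrightarrow> s \<in> partition_sums u c d \<Longrightarrow> s < e"
proof -
  obtain \<delta> where "0 < \<delta>" and \<delta>: "\<forall>(I::nat set) x y. finite I \<longrightarrow>
      (\<forall>i\<in>I. a \<le> x i \<and> x i \<le> y i \<and> y i \<le> b) \<longrightarrow>
      disjoint_family_on (\<lambda>i. {x i<..<y i}) I \<longrightarrow> (\<Sum>i\<in>I. y i - x i) < \<delta> \<longrightarrow>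
      (\<Sum>i\<in>I. \<bar>u (y i) - u (x i)\<bar>) < e"
    using absolutely_continuous_fun_finite[OF assms, where 'i = nat] by blast
  have "s < e" if "a \<le> c" "d \<le> b" "d - c < \<delta>" and s: "s \<in> partition_sums u c d" for c d s
  proof -
    obtain n t where t: "s = (\<Sum>j<n. \<bar>u (t (Suc j)) - u (t j)\<bar>)"
      "t 0 = c" "t n = d" "\<forall>j<n. t j \<le> t (Suc j)"
      using s by (auto simp: partition_sums_def)
    note mono = partition_mono[OF t(4)]
    have dis: "disjoint_family_on (\<lambda>i. {t i<..<t (Suc i)}) {..<n}"
      unfolding disjoint_family_on_def
    proof (intro ballI impI)
      fix i j assume ij: "i \<in> {..<n}" "j \<in> {..<n}" "i \<noteq> j"
      show "{t i<..<t (Suc i)} \<inter> {t j<..<t (Suc j)} = {}"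
      proof (cases "i < j")
        case True
        then have "t (Suc i) \<le> t j" using mono[of "Suc i" j] ij by simp
        then show ?thesis by auto
      next
        case False
        then have "t (Suc j) \<le> t i" using mono[of "Suc j" i] ij by simp
        then show ?thesis by auto
      qed
    qed
    have "(\<Sum>j<n. t (Suc j) - t j) = d - c"
      using sum_lessThan_telescope[of t n] t by simp
    moreover have "a \<le> t i \<and> t i \<le> t (Suc i) \<and> t (Suc i) \<le> b" if "i < n" for i
      using mono[of 0 i] mono[of "Suc i" n] t that \<open>a \<le> c\<close> \<open>d \<le> b\<close> by auto
    ultimately show "s < e"
      using \<delta>[rule_format, of "{..<n}" t "\<lambda>i. t (Suc i)"] dis \<open>d - c < \<delta>\<close> t(1) by auto
  qed
  with \<open>0 < \<delta>\<close> show thesis using that by blast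
qed

lemma absolutely_continuous_fun_imp_bounded_variation:
  assumes ac: "absolutely_continuous_fun a b u" and "a \<le> b"
  shows "bounded_variation u a b"
proof -
  obtain \<delta> where "0 < \<delta>" and
    \<delta>: "\<And>c d s. a \<le> c \<Longrightarrow> d \<le> b \<Longrightarrow> d - c < \<delta> \<Longrightarrow> s \<in> partition_sums u c d \<Longrightarrow> s < 1"
    using absolutely_continuous_fun_partition_sums[OF ac, of 1] by auto
  obtain n :: nat where n: "b - a < real n * (\<delta> / 2)"
    using reals_Archimedean3[of "\<delta> / 2"] half_gt_zero[OF \<open>0 < \<delta>\<close>] by blast
  \<comment> \<open>Each step of length \<open>\<delta> / 2\<close>, safely below
    \<open>\<delta>\<close>, has variation at most 1; the minimum stops the march at
    \<open>b\<close>.\<close>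
  have "bounded_variation u a (min b (a + real k * (\<delta> / 2)))" for k
  proof (induction k)
    case 0
    then show ?case using \<open>a \<le> b\<close> by (simp add: bounded_variation_def partition_sums_singleton)
  next
    case (Suc k)
    let ?c = "min b (a + real k * (\<delta> / 2))" and ?d = "min b (a + real (Suc k) * (\<delta> / 2))"
    have cd: "a \<le> ?c" "?c \<le> ?d" "?d \<le> b" "?d - ?c < \<delta>"
      using \<open>0 < \<delta>\<close> \<open>a \<le> b\<close> by (auto simp: min_def field_simps)
    have "s \<le> 1" if "s \<in> partition_sums u ?c ?d" for s
      using \<delta>[OF cd(1,3,4) that] by simp
    then have "bounded_variation u ?c ?d" by (auto simp: bounded_variation_def bdd_above_def)
    then show ?case using bounded_variation_join[OF cd(1,2) Suc] by simp
  qed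
  from this[of n] show ?thesis using n by (simp add: min_def split: if_splits)
qed

lemma absolutely_continuous_fun_total_variation_small:
  assumes ac: "absolutely_continuous_fun a b u" and "0 < e"
  obtains \<delta> where "0 < \<delta>"
    "\<And>c d. a \<le> c \<Longrightarrow> c \<le> d \<Longrightarrow> d \<le> b \<Longrightarrow> d - c < \<delta> \<Longrightarrow> total_variation u c d \<le> e"
proof -
  obtain \<delta> where "0 < \<delta>" and
    \<delta>: "\<And>c d s. a \<le> c \<Longrightarrow> d \<le> b \<Longrightarrow> d - c < \<delta> \<Longrightarrow> s \<in> partition_sums u c d \<Longrightarrow> s < e"
    using absolutely_continuous_fun_partition_sums[OF assms] by metis
  then show thesis
    by (intro that[of \<delta>] total_variation_le) (auto intro: less_imp_le)
qed

lemma continuous_on_total_variation: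
  assumes ac: "absolutely_continuous_fun a b u"
  shows "continuous_on {a..b} (total_variation u a)"
  unfolding continuous_on_iff dist_real_def
proof (intro ballI allI impI)
  fix s e :: real assume s: "s \<in> {a..b}" and "0 < e"
  then obtain \<delta> where "0 < \<delta>" and
    \<delta>: "\<And>c d. a \<le> c \<Longrightarrow> c \<le> d \<Longrightarrow> d \<le> b \<Longrightarrow> d - c < \<delta> \<Longrightarrow> total_variation u c d \<le> e / 2"
    using absolutely_continuous_fun_total_variation_small[OF ac, of "e / 2"] by auto
  have bv: "bounded_variation u a b"
    using absolutely_continuous_fun_imp_bounded_variation[OF ac] s by auto
  have main: "\<bar>total_variation u a d - total_variation u a c\<bar> < e"
    if "a \<le> c" "c \<le> d" "d \<le> b" "d - c < \<delta>" for c d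
  proof -
    have bv': "bounded_variation u a d" "bounded_variation u c d"
      using that by (auto intro: bounded_variation_subinterval[OF bv])
    show ?thesis
      using total_variation_add[OF bv'(1), of c] total_variation_nonneg[OF bv'(2)] \<delta>[of c d] that
        \<open>0 < e\<close> by auto
  qed
  have "\<bar>total_variation u a t - total_variation u a s\<bar> < e" if "t \<in> {a..b}" "\<bar>t - s\<bar> < \<delta>" for t
    using main[of s t] main[of t s] that s by (cases "s \<le> t") (auto simp: abs_minus_commute)
  then show "\<exists>d>0. \<forall>x'\<in>{a..b}. \<bar>x' - s\<bar> < d \<longrightarrow> \<bar>total_variation u a x' - total_variation u a s\<bar> < e"
    using \<open>0 < \<delta>\<close> by blast
qed

lemma absolutely_continuous_fun_imp_continuous_on:
  assumes ac: "absolutely_continuous_fun a b u"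
  shows "continuous_on {a..b} u"
  unfolding continuous_on_iff dist_real_def
proof (intro ballI allI impI)
  fix s e :: real assume s: "s \<in> {a..b}" and "0 < e"
  then obtain \<delta> where "0 < \<delta>" and
    \<delta>: "\<And>c d s. a \<le> c \<Longrightarrow> d \<le> b \<Longrightarrow> d - c < \<delta> \<Longrightarrow> s \<in> partition_sums u c d \<Longrightarrow> s < e"
    using absolutely_continuous_fun_partition_sums[OF ac] by metis
  have "\<bar>u t - u s\<bar> < e" if "t \<in> {a..b}" "\<bar>t - s\<bar> < \<delta>" for t
    using \<delta>[of s t, OF _ _ _ abs_diff_in_partition_sums]
      \<delta>[of t s, OF _ _ _ abs_diff_in_partition_sums] that s
    by (cases "s \<le> t") (auto simp: abs_minus_commute)
  then show "\<exists>d>0. \<forall>x'\<in>{a..b}. \<bar>x' - s\<bar> < d \<longrightarrow> \<bar>u x' - u s\<bar> < e"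
    using \<open>0 < \<delta>\<close> by blast
qed

lemma absolutely_continuous_fun_diff:
  assumes "absolutely_continuous_fun a b u" "absolutely_continuous_fun a b v"
  shows "absolutely_continuous_fun a b (\<lambda>t. u t - v t)"
  unfolding absolutely_continuous_fun_def
proof (intro allI impI)
  fix e :: real assume "0 < e"
  then have e2: "0 < e / 2" by simp
  obtain d1 where d1: "0 < d1" "\<forall>(I::nat set) x y. finite I \<longrightarrow>
      (\<forall>i\<in>I. a \<le> x i \<and> x i \<le> y i \<and> y i \<le> b) \<longrightarrow>
      disjoint_family_on (\<lambda>i. {x i<..<y i}) I \<longrightarrow> (\<Sum>i\<in>I. y i - x i) < d1 \<longrightarrow>
      (\<Sum>i\<in>I. \<bar>u (y i) - u (x i)\<bar>) < e / 2"
    using absolutely_continuous_fun_finite[OF assms(1) e2, where 'i = nat] by blast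
  obtain d2 where d2: "0 < d2" "\<forall>(I::nat set) x y. finite I \<longrightarrow>
      (\<forall>i\<in>I. a \<le> x i \<and> x i \<le> y i \<and> y i \<le> b) \<longrightarrow>
      disjoint_family_on (\<lambda>i. {x i<..<y i}) I \<longrightarrow> (\<Sum>i\<in>I. y i - x i) < d2 \<longrightarrow>
      (\<Sum>i\<in>I. \<bar>v (y i) - v (x i)\<bar>) < e / 2"
    using absolutely_continuous_fun_finite[OF assms(2) e2, where 'i = nat] by blast
  have "(\<Sum>i<n. \<bar>(u (y i) - v (y i)) - (u (x i) - v (x i))\<bar>) < e"
    if xy: "\<forall>i<n. a \<le> x i \<and> x i \<le> y i \<and> y i \<le> b"
      and dis: "disjoint_family_on (\<lambda>i. {x i<..<y i}) {..<n}"
      and len: "(\<Sum>i<n. y i - x i) < min d1 d2" for n :: nat and x y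
  proof -
    have "(\<Sum>i<n. \<bar>(u (y i) - v (y i)) - (u (x i) - v (x i))\<bar>)
        \<le> (\<Sum>i<n. \<bar>u (y i) - u (x i)\<bar> + \<bar>v (y i) - v (x i)\<bar>)"
      by (intro sum_mono) auto
    also have "\<dots> = (\<Sum>i<n. \<bar>u (y i) - u (x i)\<bar>) + (\<Sum>i<n. \<bar>v (y i) - v (x i)\<bar>)"
      by (rule sum.distrib)
    also have "\<dots> < e / 2 + e / 2"
      using xy len by (intro add_strict_mono d1(2)[rule_format] d2(2)[rule_format] dis) auto
    finally show ?thesis by simp
  qed
  then show "\<exists>\<delta>>0. \<forall>(n::nat) x y.
      (\<forall>i<n. a \<le> x i \<and> x i \<le> y i \<and> y i \<le> b) \<and> disjoint_family_on (\<lambda>i. {x i<..<y i}) {..<n} \<and>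
      (\<Sum>i<n. y i - x i) < \<delta> \<longrightarrow> (\<Sum>i<n. \<bar>u (y i) - v (y i) - (u (x i) - v (x i))\<bar>) < e"
    using d1(1) d2(1) by (intro exI[of _ "min d1 d2"]) auto
qed

section \<open>Differentiability almost everywhere, and monotonicity from the derivative\<close>

lemma strict_mono_on_differentiable_ae:
  fixes f :: "real \<Rightarrow> real"
  assumes "a \<le> b" "strict_mono_on {a..b} f" "continuous_on {a..b} f"
  shows "negligible {x \<in> {a<..<b}. \<not> (\<exists>D. (f has_real_derivative D) (at x))}"
proof -
  define c where "c x = max a (min b x)" for x
  \<comment> \<open>Extension of \<open>f\<close> by slope 1 outside \<open>{a..b}\<close>: strictly
    increasing, continuous and onto, so the theorem for the whole line applies.\<close>
  define g where "g x = f (c x) + (x - c x)" for x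
  have c: "c x \<in> {a..b}" for x using \<open>a \<le> b\<close> by (auto simp: c_def)
  have c_mono: "c x \<le> c y" "x - c x \<le> y - c y" if "x \<le> y" for x y
    using that \<open>a \<le> b\<close> by (auto simp: c_def min_def max_def)
  have f_mono: "f (c x) \<le> f (c y)" if "x \<le> y" for x y
    using c_mono(1)[OF that] strict_mono_onD[OF assms(2) c c, of x y] by (cases "c x = c y") auto
  have mono: "strict_mono g"
  proof (rule strict_monoI)
    fix x y :: real assume "x < y"
    show "g x < g y"
    proof (cases "c x = c y")
      case True
      then show ?thesis using \<open>x < y\<close> by (simp add: g_def)
    next
      case False
      then have "c x < c y" using c_mono(1)[of x y] \<open>x < y\<close> by simp
      then have "f (c x) < f (c y)" using strict_mono_onD[OF assms(2) c c] by blast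
      then show ?thesis using c_mono(2)[of x y] \<open>x < y\<close> by (simp add: g_def)
    qed
  qed
  have "continuous_on UNIV c" unfolding c_def by (intro continuous_intros)
  moreover have "continuous_on UNIV (\<lambda>x. f (c x))"
    by (rule continuous_on_compose2[OF assms(3) \<open>continuous_on UNIV c\<close>]) (use c in auto)
  ultimately have cont: "continuous_on UNIV g"
    unfolding g_def by (intro continuous_intros)
  have "\<exists>x. g x = y" for y
  proof -
    \<comment> \<open>Points where the two outer rays of \<open>g\<close> would attain
      \<open>y\<close>, pushed back to \<open>a\<close> and \<open>b\<close> if they are not on the
      ray.\<close>
    define l where "l = min a (y - f a + a)"
    define r where "r = max b (y - f b + b)"
    have "g l \<le> y" "y \<le> g r" "l \<le> r"
      using \<open>a \<le> b\<close> by (auto simp: g_def c_def l_def r_def min_def max_def)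
    then show ?thesis using IVT'[of g l y r] continuous_on_subset[OF cont] by auto
  qed
  then have surj: "surj g" by (metis surjI)
  have "{x \<in> {a<..<b}. \<not> (\<exists>D. (f has_real_derivative D) (at x))}
      \<subseteq> {x. \<not> (\<exists>D. (g has_real_derivative D) (at x))}"
  proof safe
    fix x D assume x: "x \<in> {a<..<b}" "(g has_real_derivative D) (at x)"
      and nd: "\<nexists>D. (f has_real_derivative D) (at x)"
    have "eventually (\<lambda>y. y \<in> {a<..<b}) (nhds x)"
      using x(1) by (intro eventually_nhds_in_open) auto
    then have "eventually (\<lambda>y. g y = f y) (nhds x)"
      by eventually_elim (auto simp: g_def c_def)
    then have "(f has_real_derivative D) (at x)"
      using x(2) DERIV_cong_ev[OF refl _ refl] by blast
    then show False using nd by blast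
  qed
  then show ?thesis
    using strict_mono_differentiable_ae[OF mono cont surj] negligible_subset by blast
qed

text \<open>A Jordan decomposition \<open>u = g - f\<close> into increasing functions built from the
  variation; the added summand \<open>t\<close> makes both parts strictly increasing.\<close>

lemma absolutely_continuous_fun_differentiable_ae:
  assumes ac: "absolutely_continuous_fun a b u" and "a \<le> b"
  shows "negligible {x \<in> {a<..<b}. \<not> (\<exists>D. (u has_real_derivative D) (at x))}"
proof -
  define f where "f t = t + total_variation u a t" for t
  define g where "g t = f t + u t" for t
  have bv: "bounded_variation u a b"
    using absolutely_continuous_fun_imp_bounded_variation[OF assms] .
  have *: "f s < f t \<and> g s < g t" if "s \<in> {a..b}" "t \<in> {a..b}" "s < t" for s t
  proof -
    have bv': "bounded_variation u a t" "bounded_variation u s t"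
      using that by (auto intro: bounded_variation_subinterval[OF bv])
    show ?thesis
      using total_variation_add[OF bv'(1), of s] abs_diff_le_total_variation[OF bv'(2)] that
      by (auto simp: f_def g_def)
  qed
  have cont: "continuous_on {a..b} f" "continuous_on {a..b} g"
    unfolding f_def g_def
    by (intro continuous_intros continuous_on_total_variation[OF ac]
        absolutely_continuous_fun_imp_continuous_on[OF ac])+
  have "negligible {x \<in> {a<..<b}. \<not> (\<exists>D. (f has_real_derivative D) (at x))}"
       "negligible {x \<in> {a<..<b}. \<not> (\<exists>D. (g has_real_derivative D) (at x))}"
    using * by (intro strict_mono_on_differentiable_ae[OF \<open>a \<le> b\<close> _ cont(1)]
        strict_mono_on_differentiable_ae[OF \<open>a \<le> b\<close> _ cont(2)] strict_mono_onI; blast)+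
  then have "negligible ({x \<in> {a<..<b}. \<not> (\<exists>D. (f has_real_derivative D) (at x))}
      \<union> {x \<in> {a<..<b}. \<not> (\<exists>D. (g has_real_derivative D) (at x))})"
    by (rule negligible_Un)
  moreover have "\<exists>D. (u has_real_derivative D) (at x)"
    if "(f has_real_derivative D1) (at x)" "(g has_real_derivative D2) (at x)" for x D1 D2
    using DERIV_diff[OF that(2,1)] by (auto simp: g_def)
  ultimately show ?thesis by (elim negligible_subset) blast
qed

text \<open>Cousin's lemma replaces the Vitali argument: points of the null set where nothing is known
  are tagged with intervals inside a small open set, where absolute continuity takes over.\<close>

lemma absolutely_continuous_fun_deriv_nonpos:
  assumes ac: "absolutely_continuous_fun a b f" and "a \<le> b" and "negligible E"
    and deriv: "\<And>x. x \<in> {a..b} \<Longrightarrow> x \<notin> E \<Longrightarrow> \<exists>D\<le>0. (f has_real_derivative D) (at x)"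
  shows "f b \<le> f a"
proof -
  \<comment> \<open>Tags with a known derivative account for \<open>e * (b - a)\<close>, tags in
    \<open>E\<close> for the extra \<open>e\<close>.\<close>
  have "f b - f a \<le> e * (b - a) + e" if "0 < e" for e
  proof -
    obtain \<delta> where "0 < \<delta>" and \<delta>: "\<forall>(I::(real \<times> real set) set) x y. finite I \<longrightarrow>
      (\<forall>i\<in>I. a \<le> x i \<and> x i \<le> y i \<and> y i \<le> b) \<longrightarrow>
      disjoint_family_on (\<lambda>i. {x i<..<y i}) I \<longrightarrow> (\<Sum>i\<in>I. y i - x i) < \<delta> \<longrightarrow>
      (\<Sum>i\<in>I. \<bar>f (y i) - f (x i)\<bar>) < e"
      using absolutely_continuous_fun_finite[OF ac \<open>0 < e\<close>, where 'i = "real \<times> real set"] by blast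
    obtain G where G: "open G" "E \<subseteq> G" "G - E \<in> lmeasurable" "emeasure lebesgue (G - E) < ennreal \<delta>"
      using sets_lebesgue_outer_open[OF negligible_imp_sets[OF \<open>negligible E\<close>] \<open>0 < \<delta>\<close>] by metis
    have GE: "G = (G - E) \<union> E" using G(2) by auto
    have Gm: "G \<in> lmeasurable"
      using GE G(3) negligible_imp_measurable[OF \<open>negligible E\<close>] by (metis fmeasurable.Un)
    have "emeasure lebesgue G = emeasure lebesgue (G - E)"
      using GE emeasure_Un_null_set[of "G - E" lebesgue E] G(3) \<open>negligible E\<close>
      by (metis fmeasurableD negligible_iff_null_sets)
    then have "emeasure lebesgue G < ennreal \<delta>" using G(4) by simp
    then have mG: "measure lebesgue G < \<delta>"
      using Gm \<open>0 < \<delta>\<close> by (simp add: emeasure_eq_measure2 ennreal_less_iff)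
    \<comment> \<open>The bounds to the right and to the left are kept apart because a tag divides
      its interval into two pieces, each estimated from the tag outwards.\<close>
    have "\<exists>d>0. \<forall>y. \<bar>y - x\<bar> < d \<longrightarrow> (x \<le> y \<longrightarrow> f y - f x \<le> e * (y - x)) \<and> (y \<le> x \<longrightarrow> f x - f y \<le> e * (x - y))"
      if x: "x \<in> {a..b} - E" for x
    proof -
      obtain D where D: "D \<le> 0" "(f has_real_derivative D) (at x)" using deriv x by blast
      have "(\<lambda>h. (f (x + h) - f x) / h) \<midarrow>0\<rightarrow> D" using D(2) by (simp add: DERIV_def)
      from LIM_D[OF this \<open>0 < e\<close>] obtain d where d: "d > 0"
        "\<And>h. h \<noteq> 0 \<Longrightarrow> \<bar>h\<bar> < d \<Longrightarrow> \<bar>(f (x + h) - f x) / h - D\<bar> < e" by auto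
      have "(x \<le> y \<longrightarrow> f y - f x \<le> e * (y - x)) \<and> (y \<le> x \<longrightarrow> f x - f y \<le> e * (x - y))"
        if "\<bar>y - x\<bar> < d" for y
      proof (cases "y = x")
        case False
        then have "(f y - f x) / (y - x) < e" using d(2)[of "y - x"] that D(1) by auto
        then show ?thesis using False by (auto simp: field_simps split: if_splits)
      qed simp
      then show ?thesis using d(1) by blast
    qed
    then obtain d where d: "\<And>x. x \<in> {a..b} - E \<Longrightarrow> d x > 0"
      "\<And>x y. x \<in> {a..b} - E \<Longrightarrow> \<bar>y - x\<bar> < d x \<Longrightarrow> x \<le> y \<Longrightarrow> f y - f x \<le> e * (y - x)"
      "\<And>x y. x \<in> {a..b} - E \<Longrightarrow> \<bar>y - x\<bar> < d x \<Longrightarrow> y \<le> x \<Longrightarrow> f x - f y \<le> e * (x - y)"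
      by metis
    define \<gamma> where "\<gamma> x = (if x \<in> E then G else if x \<in> {a..b} then ball x (d x) else ball x 1)" for x
    have "gauge \<gamma>"
      unfolding gauge_def \<gamma>_def using G d(1) by auto
    then obtain p where p: "p tagged_division_of {a..b}" "\<gamma> fine p"
      using fine_division_exists_real by blast
    note pD = tagged_division_ofD[OF p(1)]
    \<comment> \<open>End points are expressed by \<open>Inf\<close> and \<open>Sup\<close>, the
      form in which \<open>additive_tagged_division_1\<close> telescopes.\<close>
    have K: "{Inf K..Sup K} = K \<and> a \<le> Inf K \<and> Inf K \<le> x \<and> x \<le> Sup K \<and> Sup K \<le> b"
      if xK: "(x, K) \<in> p" for x K
    proof -
      obtain u v where uv: "K = {u..v}" using pD(4)[OF xK] by auto
      have "x \<in> {u..v}" using pD(2)[OF xK] uv by simp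
      then show ?thesis using pD(3)[OF xK] uv by auto
    qed
    define B where "B = p \<inter> {(x, K). x \<in> E}"
    have fin: "finite p" "finite B" using pD(1) by (auto simp: B_def)
    have B: "(\<Sum>i\<in>B. \<bar>f (Sup (snd i)) - f (Inf (snd i))\<bar>) < e"
    proof -
      have dis: "disjoint_family_on (\<lambda>i. {Inf (snd i)<..<Sup (snd i)}) B"
        unfolding disjoint_family_on_def
      proof (intro ballI impI)
        fix i j assume ij: "i \<in> B" "j \<in> B" "i \<noteq> j"
        then have "interior (snd i) \<inter> interior (snd j) = {}"
          using pD(5)[of "fst i" "snd i" "fst j" "snd j"] by (auto simp: B_def)
        moreover have "interior (snd i) = {Inf (snd i)<..<Sup (snd i)}" if "i \<in> p" for i
          using K[of "fst i" "snd i"] that interior_atLeastAtMost_real by (metis prod.collapse)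
        ultimately show "{Inf (snd i)<..<Sup (snd i)} \<inter> {Inf (snd j)<..<Sup (snd j)} = {}"
          using ij by (auto simp: B_def)
      qed
      have sub: "{Inf (snd i)<..<Sup (snd i)} \<subseteq> G" if "i \<in> B" for i
      proof -
        have "snd i \<subseteq> G" using that fineD[OF p(2), of "fst i" "snd i"] by (auto simp: B_def \<gamma>_def)
        moreover have "{Inf (snd i)..Sup (snd i)} = snd i"
          using that K[of "fst i" "snd i"] by (simp add: B_def)
        then have "{Inf (snd i)<..<Sup (snd i)} \<subseteq> snd i"
          by (metis greaterThanLessThan_subseteq_atLeastAtMost_iff order_refl)
        ultimately show ?thesis by blast
      qed
      have "(\<Sum>i\<in>B. Sup (snd i) - Inf (snd i)) = (\<Sum>i\<in>B. measure lebesgue {Inf (snd i)<..<Sup (snd i)})"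
        using K by (intro sum.cong) (fastforce simp: B_def)+
      also have "\<dots> = measure lebesgue (\<Union>i\<in>B. {Inf (snd i)<..<Sup (snd i)})"
        using fin(2) dis emeasure_bounded_finite[OF bounded_Ioo]
        by (intro measure_finite_Union[symmetric]) (auto simp: less_top)
      also have "\<dots> \<le> measure lebesgue G"
        using sub Gm fin(2) by (intro measure_mono_fmeasurable sets.finite_UN) auto
      finally have "(\<Sum>i\<in>B. Sup (snd i) - Inf (snd i)) < \<delta>" using mG by simp
      moreover have "\<forall>i\<in>B. a \<le> Inf (snd i) \<and> Inf (snd i) \<le> Sup (snd i) \<and> Sup (snd i) \<le> b"
        using K by (fastforce simp: B_def)
      ultimately show ?thesis by (intro \<delta>[rule_format, OF fin(2) _ dis]) auto
    qed
    have "f b - f a = (\<Sum>i\<in>p. f (Sup (snd i)) - f (Inf (snd i)))"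
      using additive_tagged_division_1[OF \<open>a \<le> b\<close> p(1), of f] by (simp add: case_prod_unfold)
    also have "\<dots> = (\<Sum>i\<in>p - B. f (Sup (snd i)) - f (Inf (snd i))) + (\<Sum>i\<in>B. f (Sup (snd i)) - f (Inf (snd i)))"
      using fin(1) by (intro sum.subset_diff) (auto simp: B_def)
    also have "\<dots> \<le> (\<Sum>i\<in>p - B. e * (Sup (snd i) - Inf (snd i))) + (\<Sum>i\<in>B. \<bar>f (Sup (snd i)) - f (Inf (snd i))\<bar>)"
    proof (intro add_mono sum_mono)
      fix i assume i: "i \<in> p - B"
      obtain x K where xK: "i = (x, K)" by (cases i)
      have mem: "(x, K) \<in> p" "x \<notin> E" using i xK by (auto simp: B_def)
      note Kx = K[OF mem(1)]
      have x: "x \<in> {a..b} - E" using Kx mem(2) by auto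
      have "K \<subseteq> ball x (d x)" using fineD[OF p(2) mem(1)] x by (auto simp: \<gamma>_def)
      then have "Inf K \<in> ball x (d x)" "Sup K \<in> ball x (d x)" using Kx by (auto simp: subset_iff)
      then have "f (Sup K) - f x \<le> e * (Sup K - x)" "f x - f (Inf K) \<le> e * (x - Inf K)"
        using d(2,3)[OF x] Kx by (auto simp: dist_real_def abs_minus_commute)
      then show "f (Sup (snd i)) - f (Inf (snd i)) \<le> e * (Sup (snd i) - Inf (snd i))"
        by (simp add: xK algebra_simps)
    qed auto
    also have "(\<Sum>i\<in>p - B. e * (Sup (snd i) - Inf (snd i))) \<le> (\<Sum>i\<in>p. e * (Sup (snd i) - Inf (snd i)))"
      using fin(1) K \<open>0 < e\<close> by (intro sum_mono2) (fastforce intro!: mult_nonneg_nonneg)+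
    also have "\<dots> = e * (\<Sum>(x, K)\<in>p. Sup K - Inf K)"
      by (simp add: sum_distrib_left case_prod_unfold)
    also have "\<dots> = e * (b - a)"
      using additive_tagged_division_1[OF \<open>a \<le> b\<close> p(1), of "\<lambda>x. x"] by simp
    finally show ?thesis using B by linarith
  qed
  then have bound: "f b - f a \<le> e * (b - a + 1)" if "0 < e" for e
    using that by (force simp: algebra_simps)
  \<comment> \<open>Rescaling by \<open>b - a + 1\<close>, which is positive even for
    \<open>a = b\<close>.\<close>
  have "f b - f a \<le> 0 + e" if "0 < e" for e
    using bound[of "e / (b - a + 1)"] that \<open>a \<le> b\<close> by simp
  then have "f b - f a \<le> 0" by (rule field_le_epsilon)
  then show ?thesis by simp
qed

subsection \<open>The complementary variable\<close>

definition clip :: "real \<Rightarrow> real \<Rightarrow> real \<Rightarrow> real" where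
  "clip l u x = max l (min u x)"

text \<open>The semigroup property behind the closed form: two successive clippings act as one
  clipping to the intersection, provided that it is nonempty.\<close>

lemma clip_clip:
  "max l l' \<le> min u u' \<Longrightarrow> clip l' u' (clip l u x) = clip (max l l') (min u u') x"
  by (auto simp: clip_def max_def min_def split: if_splits)

lemma clip_mem: "l \<le> u \<Longrightarrow> clip l u x \<in> {l..u}"
  by (auto simp: clip_def)

text \<open>\<open>min\<close> and \<open>max\<close> are non-expansive for the maximum distance.
  The bound \<open>m\<close> is reproduced rather than enlarged, so errors do not accumulate over
  arbitrarily many clippings.\<close>

lemma abs_clip_diff_le:
  assumes "\<bar>l - l'\<bar> \<le> m" "\<bar>u - u'\<bar> \<le> m" "\<bar>x - x'\<bar> \<le> m"
  shows "\<bar>clip l u x - clip l' u' x'\<bar> \<le> m"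
proof -
  have "\<bar>min u x - min u' x'\<bar> \<le> m" using assms by linarith
  then show ?thesis using assms(1) unfolding clip_def by linarith
qed

text \<open>The reflection \<open>y \<mapsto> x - y\<close> exchanges the two thresholds. It turns
  projections of the stop variable onto \<open>{\<alpha>..\<beta>}\<close> into clippings of the
  complementary variable.\<close>

lemma diff_clip:
  assumes "l \<le> u"
  shows "x - clip l u y = clip (x - u) (x - l) (x - y)"
  using assms unfolding clip_def by linarith

lemma closest_point_Icc:
  fixes \<alpha> \<beta> x :: real
  assumes "\<alpha> \<le> \<beta>"
  shows "closest_point {\<alpha>..\<beta>} x = clip \<alpha> \<beta> x"
  using assms
  by (intro closest_point_unique[symmetric]) (auto simp: clip_def dist_real_def max_def min_def)

text \<open>On an interval where \<open>\<pi>\<close> oscillates by less than \<open>\<beta> - \<alpha>\<close> at most one of the two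
  thresholds is active, which gives the closed form of the complementary variable \<open>W\<close>.\<close>

definition play :: "real \<Rightarrow> real \<Rightarrow> real \<Rightarrow> (real \<Rightarrow> real) \<Rightarrow> real \<Rightarrow> (real \<Rightarrow> real) \<Rightarrow> bool" where
  "play c \<alpha> \<beta> \<pi> \<delta> W \<longleftrightarrow>
     W 0 = \<pi> 0 - closest_point {\<alpha>..\<beta>} (\<pi> 0) \<and>
     (\<forall>s t. 0 \<le> s \<longrightarrow> s \<le> t \<longrightarrow> t \<le> c \<longrightarrow> t - s < \<delta> \<longrightarrow>
        W t = clip (Sup (\<pi> ` {s..t}) - \<beta>) (Inf (\<pi> ` {s..t}) - \<alpha>) (W s))"

lemma playD:
  "play c \<alpha> \<beta> \<pi> \<delta> W \<Longrightarrow> 0 \<le> s \<Longrightarrow> s \<le> t \<Longrightarrow> t \<le> c \<Longrightarrow> t - s < \<delta> \<Longrightarrow>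
    W t = clip (Sup (\<pi> ` {s..t}) - \<beta>) (Inf (\<pi> ` {s..t}) - \<alpha>) (W s)"
  unfolding play_def by blast

section \<open>The closed form of the complementary variable on windows of small oscillation\<close>

locale play_input =
  fixes T \<alpha> \<beta> \<delta> :: real and \<pi> :: "real \<Rightarrow> real"
  assumes T: "0 < T" and \<alpha>\<beta>: "\<alpha> < \<beta>" and \<delta>: "0 < \<delta>"
    and cont: "continuous_on {0..T} \<pi>"
    and osc: "\<And>s t. s \<in> {0..T} \<Longrightarrow> t \<in> {0..T} \<Longrightarrow> \<bar>t - s\<bar> < \<delta> \<Longrightarrow> \<bar>\<pi> t - \<pi> s\<bar> \<le> \<beta> - \<alpha>"
begin

lemma bdd:
  assumes "0 \<le> s" "t \<le> T"
  shows "bdd_above (\<pi> ` {s..t})" "bdd_below (\<pi> ` {s..t})"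
proof -
  have "continuous_on {s..t} \<pi>" using assms by (intro continuous_on_subset[OF cont]) auto
  then have "bounded (\<pi> ` {s..t})"
    using compact_continuous_image compact_imp_bounded by blast
  then show "bdd_above (\<pi> ` {s..t})" "bdd_below (\<pi> ` {s..t})"
    by (auto intro: bounded_imp_bdd_above bounded_imp_bdd_below)
qed

lemma Sup_upper: "0 \<le> s \<Longrightarrow> s \<le> r \<Longrightarrow> r \<le> t \<Longrightarrow> t \<le> T \<Longrightarrow> \<pi> r \<le> Sup (\<pi> ` {s..t})"
  by (rule cSup_upper[OF imageI bdd(1)]) auto

lemma Inf_lower: "0 \<le> s \<Longrightarrow> s \<le> r \<Longrightarrow> r \<le> t \<Longrightarrow> t \<le> T \<Longrightarrow> Inf (\<pi> ` {s..t}) \<le> \<pi> r"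
  by (rule cInf_lower[OF imageI bdd(2)]) auto

lemma Sup_least: "s \<le> t \<Longrightarrow> (\<And>r. s \<le> r \<Longrightarrow> r \<le> t \<Longrightarrow> \<pi> r \<le> m) \<Longrightarrow> Sup (\<pi> ` {s..t}) \<le> m"
  by (rule cSup_least) auto

lemma Inf_greatest: "s \<le> t \<Longrightarrow> (\<And>r. s \<le> r \<Longrightarrow> r \<le> t \<Longrightarrow> m \<le> \<pi> r) \<Longrightarrow> m \<le> Inf (\<pi> ` {s..t})"
  by (rule cInf_greatest) auto

lemma Sup_split:
  assumes "0 \<le> s" "s \<le> r" "r \<le> t" "t \<le> T"
  shows "Sup (\<pi> ` {s..t}) = max (Sup (\<pi> ` {s..r})) (Sup (\<pi> ` {r..t}))"
proof -
  have "\<pi> ` {s..t} = \<pi> ` {s..r} \<union> \<pi> ` {r..t}"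
    using assms by (simp add: image_Un[symmetric] ivl_disj_un_two_touch)
  then show ?thesis
    using assms by (simp add: cSup_union_distrib bdd sup_max)
qed

lemma Inf_split:
  assumes "0 \<le> s" "s \<le> r" "r \<le> t" "t \<le> T"
  shows "Inf (\<pi> ` {s..t}) = min (Inf (\<pi> ` {s..r})) (Inf (\<pi> ` {r..t}))"
proof -
  have "\<pi> ` {s..t} = \<pi> ` {s..r} \<union> \<pi> ` {r..t}"
    using assms by (simp add: image_Un[symmetric] ivl_disj_un_two_touch)
  then show ?thesis
    using assms by (simp add: cInf_union_distrib bdd inf_min)
qed

text \<open>Here the oscillation bound enters: the intervals
  \<open>{\<pi> r - \<beta>..\<pi> r - \<alpha>}\<close> over a window shorter than
  \<open>\<delta>\<close> have a common point, as \<open>clip_clip\<close> demands.\<close>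

lemma thresholds:
  assumes "0 \<le> s" "s \<le> t" "t \<le> T" "t - s < \<delta>"
  shows "Sup (\<pi> ` {s..t}) - \<beta> \<le> Inf (\<pi> ` {s..t}) - \<alpha>"
proof -
  have "Sup (\<pi> ` {s..t}) - (\<beta> - \<alpha>) \<le> \<pi> q" if "s \<le> q" "q \<le> t" for q
  proof -
    have "Sup (\<pi> ` {s..t}) \<le> \<pi> q + (\<beta> - \<alpha>)"
    proof (rule Sup_least)
      fix r assume "s \<le> r" "r \<le> t"
      then have "\<bar>r - q\<bar> < \<delta>" using that assms by linarith
      then show "\<pi> r \<le> \<pi> q + (\<beta> - \<alpha>)"
        using osc[of q r] that assms \<open>s \<le> r\<close> \<open>r \<le> t\<close> by auto
    qed (rule assms)
    then show ?thesis by simp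
  qed
  from Inf_greatest[OF assms(2) this] show ?thesis by simp
qed

lemma clip_split:
  assumes "0 \<le> s" "s \<le> r" "r \<le> t" "t \<le> T" "t - s < \<delta>"
  shows "clip (Sup (\<pi> ` {r..t}) - \<beta>) (Inf (\<pi> ` {r..t}) - \<alpha>)
      (clip (Sup (\<pi> ` {s..r}) - \<beta>) (Inf (\<pi> ` {s..r}) - \<alpha>) x)
    = clip (Sup (\<pi> ` {s..t}) - \<beta>) (Inf (\<pi> ` {s..t}) - \<alpha>) x"
proof -
  have eq: "Sup (\<pi> ` {s..t}) - \<beta> = max (Sup (\<pi> ` {s..r}) - \<beta>) (Sup (\<pi> ` {r..t}) - \<beta>)"
    "Inf (\<pi> ` {s..t}) - \<alpha> = min (Inf (\<pi> ` {s..r}) - \<alpha>) (Inf (\<pi> ` {r..t}) - \<alpha>)"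
    using Sup_split[OF assms(1-4)] Inf_split[OF assms(1-4)] by (auto simp: max_def min_def)
  show ?thesis
    unfolding eq using thresholds[of s t] assms eq by (intro clip_clip) auto
qed

text \<open>The horizon grows by \<open>\<delta> / 2\<close> at a time, using the closed form
  started at the old horizon \<open>c\<close>. A window reaching beyond \<open>c\<close> is either
  split at \<open>c\<close> or is a tail of the window from \<open>c\<close>, whose length is still
  below \<open>\<delta>\<close>; \<open>clip_split\<close> settles both cases.\<close>

lemma play_exists: "\<exists>W. play T \<alpha> \<beta> \<pi> \<delta> W"
proof -
  have "\<exists>W. play (min T (real k * (\<delta> / 2))) \<alpha> \<beta> \<pi> \<delta> W" for k
  proof (induction k)
    case 0
    have "clip (\<pi> 0 - \<beta>) (\<pi> 0 - \<alpha>) (\<pi> 0 - clip \<alpha> \<beta> (\<pi> 0)) = \<pi> 0 - clip \<alpha> \<beta> (\<pi> 0)"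
      using \<alpha>\<beta> by (auto simp: clip_def)
    moreover have "s = 0 \<and> t = 0" if "0 \<le> s" "s \<le> t" "t \<le> 0" for s t :: real
      using that by auto
    ultimately have "play 0 \<alpha> \<beta> \<pi> \<delta> (\<lambda>_. \<pi> 0 - closest_point {\<alpha>..\<beta>} (\<pi> 0))"
      using \<alpha>\<beta> unfolding play_def by (fastforce simp: closest_point_Icc)
    then show ?case using T by auto
  next
    case (Suc k)
    define c where "c = min T (real k * (\<delta> / 2))"
    define c' where "c' = min T (real (Suc k) * (\<delta> / 2))"
    have c: "0 \<le> c" "c \<le> T" "c' \<le> T" "c' - c \<le> \<delta> / 2"
      using T \<delta> by (auto simp: c_def c'_def min_def field_simps)
    obtain W where W: "play c \<alpha> \<beta> \<pi> \<delta> W" using Suc by (auto simp: c_def)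
    define W' where "W' t = (if t \<le> c then W t
      else clip (Sup (\<pi> ` {c..t}) - \<beta>) (Inf (\<pi> ` {c..t}) - \<alpha>) (W c))" for t
    have "W' t = clip (Sup (\<pi> ` {s..t}) - \<beta>) (Inf (\<pi> ` {s..t}) - \<alpha>) (W' s)"
      if st: "0 \<le> s" "s \<le> t" "t \<le> c'" "t - s < \<delta>" for s t
    proof (cases "t \<le> c")
      case True
      then show ?thesis using playD[OF W st(1,2) _ st(4)] st by (simp add: W'_def)
    next
      case t: False
      show ?thesis
      proof (cases "s \<le> c")
        case True
        have "W c = clip (Sup (\<pi> ` {s..c}) - \<beta>) (Inf (\<pi> ` {s..c}) - \<alpha>) (W s)"
          using playD[OF W st(1) True order_refl] st t by simp
        then show ?thesis
          using clip_split[of s c t "W s"] st t c True by (simp add: W'_def)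
      next
        case False
        then show ?thesis
          using clip_split[of c s t "W c"] st t c \<delta> by (simp add: W'_def)
      qed
    qed
    moreover have "W' 0 = \<pi> 0 - closest_point {\<alpha>..\<beta>} (\<pi> 0)"
      using c W by (simp add: W'_def play_def)
    ultimately have "play c' \<alpha> \<beta> \<pi> \<delta> W'" unfolding play_def by blast
    then show ?case by (auto simp: c'_def)
  qed
  moreover obtain n where "T < real n * (\<delta> / 2)"
    using reals_Archimedean3[of "\<delta> / 2"] \<delta> half_gt_zero by blast
  ultimately show ?thesis by (metis less_imp_le min.absorb1)
qed

context
  fixes W :: "real \<Rightarrow> real"
  assumes W: "play T \<alpha> \<beta> \<pi> \<delta> W"
begin

text \<open>The degenerate window at \<open>t\<close> expresses the constraint on \<open>W t\<close>
  as a fixed-point equation, which allows \<open>W t\<close> to be compared with another clipping by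
  \<open>abs_clip_diff_le\<close>.\<close>

lemma play_clip_self:
  assumes "t \<in> {0..T}"
  shows "W t = clip (\<pi> t - \<beta>) (\<pi> t - \<alpha>) (W t)"
proof -
  have "W t = clip (Sup (\<pi> ` {t..t}) - \<beta>) (Inf (\<pi> ` {t..t}) - \<alpha>) (W t)"
    using assms \<delta> by (intro playD[OF W]) auto
  then show ?thesis
    by (simp only: atLeastAtMost_singleton image_insert image_empty cSup_singleton cInf_singleton)
qed

lemma play_bounds:
  assumes "t \<in> {0..T}"
  shows "\<pi> t - \<beta> \<le> W t \<and> W t \<le> \<pi> t - \<alpha>"
proof -
  have "clip (\<pi> t - \<beta>) (\<pi> t - \<alpha>) (W t) \<in> {\<pi> t - \<beta>..\<pi> t - \<alpha>}"
    using \<alpha>\<beta> by (intro clip_mem) simp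
  then show ?thesis using play_clip_self[OF assms] by (metis atLeastAtMost_iff)
qed

text \<open>Since \<open>W s\<close> already satisfies its constraint at time \<open>s\<close>,
  clipping can raise it by at most \<open>Sup - \<pi> s\<close> and lower it by at most
  \<open>\<pi> s - Inf\<close>.\<close>

lemma play_diff_le:
  assumes "0 \<le> s" "s \<le> t" "t \<le> T" "t - s < \<delta>"
  shows "\<bar>W t - W s\<bar> \<le> Sup (\<pi> ` {s..t}) - Inf (\<pi> ` {s..t})"
proof -
  have "\<pi> s - \<beta> \<le> W s" "W s \<le> \<pi> s - \<alpha>" using play_bounds[of s] assms by auto
  moreover have "Inf (\<pi> ` {s..t}) \<le> \<pi> s" "\<pi> s \<le> Sup (\<pi> ` {s..t})"
    using Inf_lower[of s s t] Sup_upper[of s s t] assms by auto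
  ultimately show ?thesis
    using playD[OF W assms] thresholds[OF assms] by (auto simp: clip_def max_def min_def)
qed

text \<open>On a short interval the increment of \<open>W\<close> is at most the oscillation of
  \<open>\<pi>\<close>, which is attained between a minimiser and a maximiser. Replacing each
  interval by the subinterval between these points keeps the family disjoint and does not lengthen
  it, so the modulus of \<open>\<pi>\<close> applies. The minimum with \<open>\<delta>\<close>
  ensures that each interval is short enough.\<close>

lemma absolutely_continuous_play:
  assumes ac: "absolutely_continuous_fun 0 T \<pi>"
  shows "absolutely_continuous_fun 0 T W"
  unfolding absolutely_continuous_fun_def
proof (intro allI impI)
  fix e :: real assume "0 < e"
  obtain d where "0 < d" and d: "\<forall>(I::nat set) x y. finite I \<longrightarrow>
      (\<forall>i\<in>I. 0 \<le> x i \<and> x i \<le> y i \<and> y i \<le> T) \<longrightarrow>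
      disjoint_family_on (\<lambda>i. {x i<..<y i}) I \<longrightarrow> (\<Sum>i\<in>I. y i - x i) < d \<longrightarrow>
      (\<Sum>i\<in>I. \<bar>\<pi> (y i) - \<pi> (x i)\<bar>) < e"
    using absolutely_continuous_fun_finite[OF ac \<open>0 < e\<close>, where 'i = nat] by blast
  have key: "\<exists>p q. s \<le> p \<and> p \<le> q \<and> q \<le> t \<and> \<bar>W t - W s\<bar> \<le> \<bar>\<pi> q - \<pi> p\<bar>"
    if st: "0 \<le> s" "s \<le> t" "t \<le> T" "t - s < \<delta>" for s t
  proof -
    have "continuous_on {s..t} \<pi>" using st by (intro continuous_on_subset[OF cont]) auto
    then obtain p q where p: "p \<in> {s..t}" "\<And>r. r \<in> {s..t} \<Longrightarrow> \<pi> p \<le> \<pi> r"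
      and q: "q \<in> {s..t}" "\<And>r. r \<in> {s..t} \<Longrightarrow> \<pi> r \<le> \<pi> q"
      using continuous_attains_inf[of "{s..t}" \<pi>] continuous_attains_sup[of "{s..t}" \<pi>] st
      by (metis atLeastatMost_empty_iff2 compact_Icc)
    have "\<bar>W t - W s\<bar> \<le> \<pi> q - \<pi> p"
      using play_diff_le[OF st] Sup_least[OF st(2), of "\<pi> q"] Inf_greatest[OF st(2), of "\<pi> p"] p q
      by fastforce
    then show ?thesis
      using p(1) q(1) by (intro exI[of _ "min p q"] exI[of _ "max p q"]) (auto simp: min_def max_def)
  qed
  have "(\<Sum>i<n. \<bar>W (y i) - W (x i)\<bar>) < e"
    if xy: "\<forall>i<n. 0 \<le> x i \<and> x i \<le> y i \<and> y i \<le> T"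
      and dis: "disjoint_family_on (\<lambda>i. {x i<..<y i}) {..<n}"
      and len: "(\<Sum>i<n. y i - x i) < min d \<delta>" for n :: nat and x y
  proof -
    have "y i - x i < \<delta>" if "i < n" for i
      using member_le_sum[of i "{..<n}" "\<lambda>i. y i - x i"] xy len that by auto
    then have "\<forall>i<n. \<exists>p q. x i \<le> p \<and> p \<le> q \<and> q \<le> y i \<and> \<bar>W (y i) - W (x i)\<bar> \<le> \<bar>\<pi> q - \<pi> p\<bar>"
      using xy key by auto
    then obtain p q where pq: "\<And>i. i < n \<Longrightarrow> x i \<le> p i \<and> p i \<le> q i \<and> q i \<le> y i
        \<and> \<bar>W (y i) - W (x i)\<bar> \<le> \<bar>\<pi> (q i) - \<pi> (p i)\<bar>"
      by metis
    have sub: "{p i<..<q i} \<subseteq> {x i<..<y i}" if "i < n" for i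
      using pq[OF that] by auto
    have dis': "disjoint_family_on (\<lambda>i. {p i<..<q i}) {..<n}"
      unfolding disjoint_family_on_def
    proof (intro ballI impI)
      fix i j assume "i \<in> {..<n}" "j \<in> {..<n}" "i \<noteq> j"
      then show "{p i<..<q i} \<inter> {p j<..<q j} = {}"
        using dis sub[of i] sub[of j] unfolding disjoint_family_on_def by blast
    qed
    have "(\<Sum>i<n. \<bar>W (y i) - W (x i)\<bar>) \<le> (\<Sum>i<n. \<bar>\<pi> (q i) - \<pi> (p i)\<bar>)"
      using pq by (intro sum_mono) auto
    also have "\<dots> < e"
    proof (rule d[rule_format, OF _ _ dis'])
      have "(\<Sum>i<n. q i - p i) \<le> (\<Sum>i<n. y i - x i)"
        using pq by (intro sum_mono) (auto intro: diff_mono)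
      then show "(\<Sum>i<n. q i - p i) < d" using len by simp
      show "0 \<le> p i \<and> p i \<le> q i \<and> q i \<le> T" if "i \<in> {..<n}" for i
        using pq[of i] xy that by (auto intro: order_trans)
    qed simp
    finally show ?thesis .
  qed
  then show "\<exists>\<delta>>0. \<forall>(n::nat) x y.
      (\<forall>i<n. 0 \<le> x i \<and> x i \<le> y i \<and> y i \<le> T) \<and> disjoint_family_on (\<lambda>i. {x i<..<y i}) {..<n} \<and>
      (\<Sum>i<n. y i - x i) < \<delta> \<longrightarrow> (\<Sum>i<n. \<bar>W (y i) - W (x i)\<bar>) < e"
    using \<open>0 < d\<close> \<delta> by (intro exI[of _ "min d \<delta>"]) auto
qed

text \<open>Forward increments decide the sign. While \<open>\<pi> t - W t < \<beta>\<close>, the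
  lower threshold stays below \<open>W t\<close> for a short time and \<open>W\<close> cannot rise;
  above \<open>\<alpha>\<close> it cannot fall. A point \<open>z\<close> of the interval above or
  below \<open>\<pi> t - W t\<close> shows that the corresponding strict inequality holds.
  \<open>V\<close> is a function on the line that agrees with \<open>W\<close> on
  \<open>{0..T}\<close>.\<close>

lemma play_deriv_normal_cone:
  assumes t: "t \<in> {0<..<T}" and deriv: "(V has_real_derivative \<nu>) (at t)"
    and V: "\<And>r. r \<in> {0..T} \<Longrightarrow> V r = W r"
  shows "\<nu> \<in> normal_cone {\<alpha>..\<beta>} (\<pi> t - W t)"
proof -
  have near: "\<exists>d>0. \<forall>h>0. h < d \<longrightarrow> t + h \<le> T \<and> h < \<delta> \<and> (\<forall>r\<in>{t..t + h}. \<bar>\<pi> r - \<pi> t\<bar> < e)" if e: "0 < e" for e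
  proof -
    obtain d where d: "d > 0" "\<And>r. r \<in> {0..T} \<Longrightarrow> \<bar>r - t\<bar> < d \<Longrightarrow> \<bar>\<pi> r - \<pi> t\<bar> < e"
      using cont[unfolded continuous_on_iff dist_real_def, rule_format, of t e] t e by auto
    then show ?thesis
      using t \<delta> by (intro exI[of _ "min d (min \<delta> (T - t))"]) auto
  qed
  have step: "W (t + h) = clip (Sup (\<pi> ` {t..t + h}) - \<beta>) (Inf (\<pi> ` {t..t + h}) - \<alpha>) (W t)"
    if "0 < h" "t + h \<le> T" "h < \<delta>" for h
    using playD[OF W, of t "t + h"] that t by auto
  have up: "\<nu> \<le> 0" if strict: "\<pi> t - W t < \<beta>"
  proof (rule ccontr)
    assume "\<not> \<nu> \<le> 0"
    then obtain d1 where d1: "d1 > 0" "\<And>h. 0 < h \<Longrightarrow> h < d1 \<Longrightarrow> V t < V (t + h)"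
      using DERIV_pos_inc_right[OF deriv] by auto
    obtain d2 where d2: "d2 > 0" "\<And>h. 0 < h \<Longrightarrow> h < d2 \<Longrightarrow> t + h \<le> T \<and> h < \<delta> \<and>
        (\<forall>r\<in>{t..t + h}. \<bar>\<pi> r - \<pi> t\<bar> < \<beta> - (\<pi> t - W t))"
      using near[of "\<beta> - (\<pi> t - W t)"] strict by auto
    define h where "h = min d1 d2 / 2"
    have h: "0 < h" "h < d1" "h < d2" using d1(1) d2(1) by (auto simp: h_def min_def)
    note h2 = d2(2)[OF h(1,3)]
    have "Sup (\<pi> ` {t..t + h}) \<le> W t + \<beta>"
    proof (rule Sup_least)
      show "\<pi> r \<le> W t + \<beta>" if "t \<le> r" "r \<le> t + h" for r
        using h2[THEN conjunct2, THEN conjunct2, rule_format, of r] that by auto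
    qed (use h in auto)
    then have "W (t + h) \<le> W t"
      using step[of h] h h2 by (auto simp: clip_def)
    then show False using d1(2)[OF h(1,2)] V[of t] V[of "t + h"] t h h2 by auto
  qed
  have down: "0 \<le> \<nu>" if strict: "\<alpha> < \<pi> t - W t"
  proof (rule ccontr)
    assume "\<not> 0 \<le> \<nu>"
    then obtain d1 where d1: "d1 > 0" "\<And>h. 0 < h \<Longrightarrow> h < d1 \<Longrightarrow> V (t + h) < V t"
      using DERIV_neg_dec_right[OF deriv] by auto
    obtain d2 where d2: "d2 > 0" "\<And>h. 0 < h \<Longrightarrow> h < d2 \<Longrightarrow> t + h \<le> T \<and> h < \<delta> \<and>
        (\<forall>r\<in>{t..t + h}. \<bar>\<pi> r - \<pi> t\<bar> < \<pi> t - W t - \<alpha>)"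
      using near[of "\<pi> t - W t - \<alpha>"] strict by auto
    define h where "h = min d1 d2 / 2"
    have h: "0 < h" "h < d1" "h < d2" using d1(1) d2(1) by (auto simp: h_def min_def)
    note h2 = d2(2)[OF h(1,3)]
    have "W t + \<alpha> \<le> Inf (\<pi> ` {t..t + h})"
    proof (rule Inf_greatest)
      show "W t + \<alpha> \<le> \<pi> r" if "t \<le> r" "r \<le> t + h" for r
        using h2[THEN conjunct2, THEN conjunct2, rule_format, of r] that by auto
    qed (use h in auto)
    then have "W t \<le> W (t + h)"
      using step[of h] h h2 by (auto simp: clip_def)
    then show False using d1(2)[OF h(1,2)] V[of t] V[of "t + h"] t h h2 by auto
  qed
  have "\<nu> * (z - (\<pi> t - W t)) \<le> 0" if "z \<in> {\<alpha>..\<beta>}" for z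
  proof (cases z "\<pi> t - W t" rule: linorder_cases)
    case less
    then show ?thesis using down that by (simp add: mult_nonneg_nonpos)
  next
    case greater
    then show ?thesis using up that by (simp add: mult_nonpos_nonneg)
  qed simp
  then show ?thesis by (simp add: normal_cone_def)
qed

end

end

subsection \<open>Well-posedness of the stop operator\<close>

text \<open>Valid for an arbitrary predicate because Lebesgue measure is complete.\<close>

lemma AE_lebesgue_on_iff_negligible:
  assumes "S \<in> sets lebesgue"
  shows "(AE x in lebesgue_on S. P x) \<longleftrightarrow> negligible {x \<in> S. \<not> P x}"
  using assms
  by (simp add: AE_restrict_space_iff completion.AE_iff_null_sets negligible_iff_null_sets)

lemma absolutely_continuous_fun_cong:
  assumes "absolutely_continuous_fun a b u" "\<And>t. t \<in> {a..b} \<Longrightarrow> u t = v t"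
  shows "absolutely_continuous_fun a b v"
  unfolding absolutely_continuous_fun_def
proof (intro allI impI)
  fix e :: real assume "0 < e"
  then obtain \<delta> where "0 < \<delta>" and \<delta>: "\<And>(n::nat) (x::nat \<Rightarrow> real) y.
      (\<forall>i<n. a \<le> x i \<and> x i \<le> y i \<and> y i \<le> b) \<and> disjoint_family_on (\<lambda>i. {x i<..<y i}) {..<n} \<and>
      (\<Sum>i<n. y i - x i) < \<delta> \<longrightarrow> (\<Sum>i<n. \<bar>u (y i) - u (x i)\<bar>) < e"
    using assms(1) unfolding absolutely_continuous_fun_def by blast
  have "(\<Sum>i<n. \<bar>v (y i) - v (x i)\<bar>) < e"
    if "(\<forall>i<n. a \<le> x i \<and> x i \<le> y i \<and> y i \<le> b) \<and> disjoint_family_on (\<lambda>i. {x i<..<y i}) {..<n} \<and>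
      (\<Sum>i<n. y i - x i) < \<delta>" for n :: nat and x y :: "nat \<Rightarrow> real"
  proof -
    have "u (y i) = v (y i) \<and> u (x i) = v (x i)" if "i < n" for i
      using \<open>_ \<and> _\<close> that assms(2)[of "x i"] assms(2)[of "y i"] by force
    then have "(\<Sum>i<n. \<bar>v (y i) - v (x i)\<bar>) = (\<Sum>i<n. \<bar>u (y i) - u (x i)\<bar>)"
      by (intro sum.cong) auto
    then show ?thesis using \<delta> that by simp
  qed
  then show "\<exists>\<delta>>0. \<forall>(n::nat) x y.
      (\<forall>i<n. a \<le> x i \<and> x i \<le> y i \<and> y i \<le> b) \<and> disjoint_family_on (\<lambda>i. {x i<..<y i}) {..<n} \<and>
      (\<Sum>i<n. y i - x i) < \<delta> \<longrightarrow> (\<Sum>i<n. \<bar>v (y i) - v (x i)\<bar>) < e"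
    using \<open>0 < \<delta>\<close> by blast
qed

text \<open>Let \<open>r\<close> be the last time before \<open>t\<close> at which the difference
  \<open>f\<close> is not positive. Beyond \<open>r\<close>, monotonicity of the normal cone gives
  \<open>(s1 - s2) * f x \<le> 0\<close>, hence a nonpositive derivative almost everywhere, and
  \<open>f\<close> cannot have become positive.\<close>

lemma stop_solution_le:
  assumes 1: "stop_solution T \<alpha> \<beta> \<pi> \<sigma>1" and 2: "stop_solution T \<alpha> \<beta> \<pi> \<sigma>2"
    and t: "t \<in> {0..T}"
  shows "\<sigma>1 t \<le> \<sigma>2 t"
proof (rule ccontr)
  define f where "f = (\<lambda>r. \<sigma>1 r - \<sigma>2 r)"
  assume "\<not> \<sigma>1 t \<le> \<sigma>2 t"
  then have ft: "0 < f t" by (simp add: f_def)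
  have ac: "absolutely_continuous_fun 0 T f"
    using 1 2 unfolding f_def by (intro absolutely_continuous_fun_diff) (auto simp: stop_solution_def W11_def)
  have cont: "continuous_on {0..t} f"
    using absolutely_continuous_fun_imp_continuous_on[OF ac] t by (auto elim: continuous_on_subset)
  have f0: "f 0 = 0" using 1 2 by (simp add: stop_solution_def f_def)
  define Z where "Z = {r \<in> {0..t}. f r \<le> 0}"
  have "closed Z"
    unfolding Z_def by (rule continuous_on_closed_Collect_le[OF cont continuous_on_const]) simp
  then have "compact Z"
    using bounded_subset[OF bounded_closed_interval, of Z 0 t]
    by (simp add: compact_eq_bounded_closed Z_def Collect_mono_iff subset_iff)
  moreover have "Z \<noteq> {}" using f0 t by (auto simp: Z_def intro!: exI[of _ 0])
  ultimately obtain r where rZ: "r \<in> Z" "\<And>x. x \<in> Z \<Longrightarrow> x \<le> r"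
    using compact_attains_sup[of Z] by blast
  then have r: "r \<in> {0..t}" "f r \<le> 0" by (auto simp: Z_def)
  have pos: "0 < f x" if "x \<in> {r<..t}" for x
    using rZ(2)[of x] that r by (force simp: Z_def)
  have "r < t" using r ft by (cases "r = t") auto
  define N where "N \<sigma> = {x \<in> {0<..<T}. \<not> (\<exists>p s. (\<pi> has_real_derivative p) (at x) \<and>
    (\<sigma> has_real_derivative s) (at x) \<and> p - s \<in> normal_cone {\<alpha>..\<beta>} (\<sigma> x))}" for \<sigma>
  have N: "negligible (N \<sigma>1)" "negligible (N \<sigma>2)"
    using 1 2 unfolding N_def stop_solution_def by (auto simp: AE_lebesgue_on_iff_negligible)
  have "f t \<le> f r"
  \<comment> \<open>The end points join the exceptional set: \<open>f\<close> is not positive at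
    \<open>r\<close>, and either point may be an end of \<open>{0..T}\<close>, where the
    differential condition says nothing.\<close>
  proof (rule absolutely_continuous_fun_deriv_nonpos[where f = f and a = r and b = t and E = "N \<sigma>1 \<union> N \<sigma>2 \<union> {r, t}"])
    show "absolutely_continuous_fun r t f"
      using r(1) t by (intro absolutely_continuous_fun_subinterval[OF ac]) auto
    show "negligible (N \<sigma>1 \<union> N \<sigma>2 \<union> {r, t})" using N by (intro negligible_Un) auto
    fix x assume x: "x \<in> {r..t}" "x \<notin> N \<sigma>1 \<union> N \<sigma>2 \<union> {r, t}"
    then have xT: "x \<in> {0<..<T}" "x \<in> {r<..t}" using r(1) t by auto
    obtain p s1 where s1: "(\<pi> has_real_derivative p) (at x)" "(\<sigma>1 has_real_derivative s1) (at x)"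
      "p - s1 \<in> normal_cone {\<alpha>..\<beta>} (\<sigma>1 x)"
      using x xT by (auto simp: N_def)
    obtain p' s2 where s2: "(\<pi> has_real_derivative p') (at x)" "(\<sigma>2 has_real_derivative s2) (at x)"
      "p' - s2 \<in> normal_cone {\<alpha>..\<beta>} (\<sigma>2 x)"
      using x xT by (auto simp: N_def)
    have "p' = p" using DERIV_unique[OF s2(1) s1(1)] .
    have mem: "\<sigma>1 x \<in> {\<alpha>..\<beta>}" "\<sigma>2 x \<in> {\<alpha>..\<beta>}"
      using 1 2 xT unfolding stop_solution_def by auto
    have "(p - s1) * (\<sigma>2 x - \<sigma>1 x) \<le> 0" "(p - s2) * (\<sigma>1 x - \<sigma>2 x) \<le> 0"
      using s1(3) s2(3) mem \<open>p' = p\<close> unfolding normal_cone_def by blast+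
    then have "(s1 - s2) * f x \<le> 0" by (simp add: f_def algebra_simps)
    then have "s1 - s2 \<le> 0" using pos[OF xT(2)] by (simp add: mult_le_0_iff)
    moreover have "(f has_real_derivative s1 - s2) (at x)"
      unfolding f_def by (intro DERIV_diff s1 s2)
    ultimately show "\<exists>D\<le>0. (f has_real_derivative D) (at x)" by blast
  qed (use \<open>r < t\<close> in simp)
  then show False using r(2) ft by simp
qed

lemma stop_solution_unique:
  assumes "stop_solution T \<alpha> \<beta> \<pi> \<sigma>1" "stop_solution T \<alpha> \<beta> \<pi> \<sigma>2"
  shows "\<sigma>1 = \<sigma>2"
proof (rule extensionalityI[of _ "{0..T}"])
  show "\<sigma>1 \<in> extensional {0..T}" "\<sigma>2 \<in> extensional {0..T}"
    using assms by (auto simp: stop_solution_def W11_def)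
  show "\<sigma>1 t = \<sigma>2 t" if "t \<in> {0..T}" for t
    using stop_solution_le[OF assms that] stop_solution_le[OF assms(2,1) that] by simp
qed

context play_input
begin

lemma play_stop_solution:
  assumes W: "play T \<alpha> \<beta> \<pi> \<delta> W" and ac: "absolutely_continuous_fun 0 T \<pi>"
  shows "stop_solution T \<alpha> \<beta> \<pi> (\<lambda>t\<in>{0..T}. \<pi> t - W t)"
proof -
  let ?\<sigma> = "\<lambda>t\<in>{0..T}. \<pi> t - W t"
  have ac\<sigma>: "absolutely_continuous_fun 0 T ?\<sigma>"
    using absolutely_continuous_fun_diff[OF ac absolutely_continuous_play[OF W ac]]
    by (rule absolutely_continuous_fun_cong) simp
  have "negligible ({t \<in> {0<..<T}. \<not> (\<exists>D. (\<pi> has_real_derivative D) (at t))}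
      \<union> {t \<in> {0<..<T}. \<not> (\<exists>D. (?\<sigma> has_real_derivative D) (at t))})"
    using T ac ac\<sigma> by (intro negligible_Un absolutely_continuous_fun_differentiable_ae) auto
  moreover have "p - s \<in> normal_cone {\<alpha>..\<beta>} (?\<sigma> t)"
    if "t \<in> {0<..<T}" "(\<pi> has_real_derivative p) (at t)" "(?\<sigma> has_real_derivative s) (at t)" for t p s
  proof -
    have "((\<lambda>r. \<pi> r - ?\<sigma> r) has_real_derivative p - s) (at t)"
      by (intro DERIV_diff that)
    then have "p - s \<in> normal_cone {\<alpha>..\<beta>} (\<pi> t - W t)"
      by (rule play_deriv_normal_cone[OF W that(1)]) simp
    then show ?thesis using that(1) by simp
  qed
  ultimately have "AE t in lebesgue_on {0<..<T}. \<exists>p s.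
      (\<pi> has_real_derivative p) (at t) \<and> (?\<sigma> has_real_derivative s) (at t) \<and>
      p - s \<in> normal_cone {\<alpha>..\<beta>} (?\<sigma> t)"
    by (subst AE_lebesgue_on_iff_negligible, simp) (elim negligible_subset, blast)
  moreover have "?\<sigma> 0 = closest_point {\<alpha>..\<beta>} (\<pi> 0)"
    using T W by (simp add: play_def)
  moreover have "?\<sigma> t \<in> {\<alpha>..\<beta>}" if "t \<in> {0..T}" for t
    using play_bounds[OF W that] that by auto
  ultimately show ?thesis
    using ac\<sigma> unfolding stop_solution_def W11_def by auto
qed

lemma compl_var_eq_play:
  assumes W: "play T \<alpha> \<beta> \<pi> \<delta> W" and ac: "absolutely_continuous_fun 0 T \<pi>" and t: "t \<in> {0..T}"
  shows "compl_var T \<alpha> \<beta> \<pi> t = W t"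
proof -
  have "stop_op T \<alpha> \<beta> \<pi> = (\<lambda>t\<in>{0..T}. \<pi> t - W t)"
    unfolding stop_op_def
    by (rule the_equality[where P = "stop_solution T \<alpha> \<beta> \<pi>"])
      (use play_stop_solution[OF W ac] stop_solution_unique in blast)+
  then show ?thesis using t by (simp add: compl_var_def)
qed

end

lemma play_input_exists:
  assumes "0 < T" "\<alpha> < \<beta>" "absolutely_continuous_fun 0 T \<pi>"
  obtains \<delta> where "play_input T \<alpha> \<beta> \<delta> \<pi>"
proof -
  have cont: "continuous_on {0..T} \<pi>"
    by (rule absolutely_continuous_fun_imp_continuous_on) fact
  have "uniformly_continuous_on {0..T} \<pi>"
    by (rule compact_uniformly_continuous[OF cont]) simp
  then obtain \<delta> where "0 < \<delta>"
    "\<And>s t. s \<in> {0..T} \<Longrightarrow> t \<in> {0..T} \<Longrightarrow> \<bar>t - s\<bar> < \<delta> \<Longrightarrow> \<bar>\<pi> t - \<pi> s\<bar> < \<beta> - \<alpha>"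
    using assms(2) unfolding uniformly_continuous_on_def dist_real_def
    by (metis diff_gt_0_iff_gt)
  then have "play_input T \<alpha> \<beta> \<delta> \<pi>"
    using assms cont by unfold_locales (auto intro: less_imp_le)
  then show thesis by (rule that)
qed

subsection \<open>Decoding of step functions\<close>

lemma partition_cover:
  fixes t :: "nat \<Rightarrow> real"
  assumes "t 0 \<le> s" "s < t M"
  shows "\<exists>k<M. s \<in> {t k..<t (Suc k)}"
  using assms(2)
proof (induction M)
  case 0
  then show ?case using assms(1) by simp
next
  case (Suc M)
  then show ?case by (cases "s < t M") (auto intro: less_SucI)
qed

lemma partition_index_unique:
  fixes t :: "nat \<Rightarrow> real"
  assumes "\<forall>k<M. t k < t (Suc k)" "j < M" "k < M"
    and "s \<in> {t j..<t (Suc j)}" "s \<in> {t k..<t (Suc k)}"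
  shows "j = k"
proof -
  have mono: "\<forall>k<M. t k \<le> t (Suc k)" using assms(1) by (auto intro: less_imp_le)
  have "\<not> j < k" using partition_mono[OF mono, of "Suc j" k] assms(2-5) by auto
  moreover have "\<not> k < j" using partition_mono[OF mono, of "Suc k" j] assms(2-5) by auto
  ultimately show ?thesis by simp
qed

lemma step_repr_exists:
  assumes "t 0 = 0" "t M = T" "\<forall>k<M. t k < t (Suc k)"
  shows "\<exists>z. step_repr T M t w z"
proof -
  define z where "z s = (if s \<in> {0..<T} then w (SOME k. k < M \<and> s \<in> {t k..<t (Suc k)})
    else if s = T then w M else undefined)" for s
  have mono: "\<forall>k<M. t k \<le> t (Suc k)" using assms(3) by (auto intro: less_imp_le)
  have "0 \<le> T" using partition_mono[OF mono, of 0 M] assms(1,2) by simp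
  have "z s = w k" if k: "k < M" "s \<in> {t k..<t (Suc k)}" for k s
  proof -
    have "(SOME k. k < M \<and> s \<in> {t k..<t (Suc k)}) = k"
      using k partition_index_unique[OF assms(3)] by (intro some_equality) blast+
    moreover have "s \<in> {0..<T}"
      using partition_mono[OF mono, of 0 k] partition_mono[OF mono, of "Suc k" M] k assms(1,2) by auto
    ultimately show ?thesis by (simp add: z_def)
  qed
  moreover have "z \<in> extensional {0..T}" using \<open>0 \<le> T\<close> by (auto simp: extensional_def z_def)
  moreover have "z T = w M" by (simp add: z_def)
  ultimately show ?thesis using assms unfolding step_repr_def by blast
qed

lemma step_repr_nodes:
  assumes "step_repr T M t v z"
  shows "\<And>k. k \<le> M \<Longrightarrow> 0 \<le> t k \<and> t k \<le> T" "\<And>s. s \<in> {0..<T} \<Longrightarrow> \<exists>k<M. s \<in> {t k..<t (Suc k)}"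
proof -
  have mono: "\<forall>k<M. t k \<le> t (Suc k)" using assms by (auto simp: step_repr_def intro: less_imp_le)
  show "0 \<le> t k \<and> t k \<le> T" if "k \<le> M" for k
    using partition_mono[OF mono, of 0 k] partition_mono[OF mono, of k M] that assms
    by (auto simp: step_repr_def)
  show "\<exists>k<M. s \<in> {t k..<t (Suc k)}" if "s \<in> {0..<T}" for s
    using partition_cover[of t s M] that assms by (auto simp: step_repr_def)
qed

lemma step_repr_diff:
  assumes "step_repr T M t v y" "step_repr T M t w z"
  shows "step_repr T M t (\<lambda>k. v k - w k) (\<lambda>s\<in>{0..T}. y s - z s)"
proof -
  have "s \<in> {0..T}" if "k < M" "s \<in> {t k..<t (Suc k)}" for k s
    using step_repr_nodes(1)[OF assms(1), of k] step_repr_nodes(1)[OF assms(1), of "Suc k"] that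
    by auto
  moreover have "T \<in> {0..T}" using step_repr_nodes(1)[OF assms(1), of M] by auto
  ultimately show ?thesis using assms unfolding step_repr_def by auto
qed

text \<open>The representation delivered here is the witness of the choice made inside
  \<open>decoder\<close>. Input and decoded function share its partition, and later arguments work
  with it.\<close>

lemma decoder_step_repr:
  assumes "z \<in> step_functions T N"
  obtains M t v where "M \<le> N" "step_repr T M t v z"
    "step_repr T M t (stop_seq \<alpha> \<beta> v) (decoder T \<alpha> \<beta> N z)"
proof -
  obtain M t v where z: "M \<le> N" "step_repr T M t v z"
    using assms by (auto simp: step_functions_def)
  then obtain y where "step_repr T M t (stop_seq \<alpha> \<beta> v) y"
    using step_repr_exists[of t M T "stop_seq \<alpha> \<beta> v"] by (auto simp: step_repr_def)
  with z have "\<exists>y. \<exists>M\<le>N. \<exists>t v. step_repr T M t v z \<and> step_repr T M t (stop_seq \<alpha> \<beta> v) y"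
    by blast
  from someI_ex[OF this] show thesis
    using that unfolding decoder_def by blast
qed

lemma decoded_compl_var_step_repr:
  assumes "f \<pi> \<in> step_functions T N"
  obtains M t v where "M \<le> N" "step_repr T M t v (f \<pi>)"
    "step_repr T M t (\<lambda>k. v k - stop_seq \<alpha> \<beta> v k) (decoded_compl_var T \<alpha> \<beta> N f \<pi>)"
proof -
  obtain M t v where *: "M \<le> N" "step_repr T M t v (f \<pi>)"
    "step_repr T M t (stop_seq \<alpha> \<beta> v) (decoder T \<alpha> \<beta> N (f \<pi>))"
    using decoder_step_repr[OF assms] by metis
  then show thesis
    using step_repr_diff[OF *(2,3)] that unfolding decoded_compl_var_def by blast
qed

text \<open>Needed because \<open>esssup_I\<close> bounds the essential supremum of measurable
  functions.\<close>

lemma step_repr_measurable: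
  assumes "step_repr T M t v z"
  shows "z \<in> borel_measurable (lebesgue_on {0<..<T})"
proof -
  define g where "g s = (\<Sum>k<M. v k * indicat_real {t k..<t (Suc k)} s)" for s
  have eq: "z s = g s" if "s \<in> space (lebesgue_on {0<..<T})" for s
  proof -
    have "s \<in> {0..<T}" using that by auto
    then obtain k where k: "k < M" "s \<in> {t k..<t (Suc k)}"
      using step_repr_nodes(2)[OF assms] by blast
    have "v j * indicat_real {t j..<t (Suc j)} s = (if j = k then v k else 0)" if "j < M" for j
    proof (cases "j = k")
      case True
      then show ?thesis using k by simp
    next
      case False
      then have "s \<notin> {t j..<t (Suc j)}"
        using partition_index_unique[OF _ that k(1) _ k(2)] assms unfolding step_repr_def by blast
      then show ?thesis using False by simp
    qed
    then have "g s = (\<Sum>j<M. if j = k then v k else 0)"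
      unfolding g_def by (intro sum.cong) auto
    then show ?thesis using k assms by (simp add: step_repr_def)
  qed
  have "g \<in> borel_measurable lborel" unfolding g_def by measurable
  then have "g \<in> borel_measurable (lebesgue_on {0<..<T})"
    using measurable_completion measurable_restrict_space1 by blast
  then show ?thesis by (subst measurable_cong[of _ z g]) (use eq in auto)
qed

text \<open>In the variable \<open>v k - stop_seq \<alpha> \<beta> v k\<close> the decoder is a
  clipping recursion of the same kind as \<open>play\<close>, started from 0. The third equation is
  the discrete counterpart of \<open>play_clip_self\<close>.\<close>

lemma stop_seq_clip:
  assumes "\<alpha> \<le> \<beta>"
  shows "v 0 - stop_seq \<alpha> \<beta> v 0 = clip (v 0 - \<beta>) (v 0 - \<alpha>) 0"
    and "v (Suc k) - stop_seq \<alpha> \<beta> v (Suc k)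
      = clip (v (Suc k) - \<beta>) (v (Suc k) - \<alpha>) (v k - stop_seq \<alpha> \<beta> v k)"
    and "v k - stop_seq \<alpha> \<beta> v k = clip (v k - \<beta>) (v k - \<alpha>) (v k - stop_seq \<alpha> \<beta> v k)"
proof -
  show w0: "v 0 - stop_seq \<alpha> \<beta> v 0 = clip (v 0 - \<beta>) (v 0 - \<alpha>) 0"
    using assms by (simp add: closest_point_Icc diff_clip)
  show wS: "v (Suc k) - stop_seq \<alpha> \<beta> v (Suc k)
      = clip (v (Suc k) - \<beta>) (v (Suc k) - \<alpha>) (v k - stop_seq \<alpha> \<beta> v k)" for k
    using assms by (simp add: closest_point_Icc diff_clip algebra_simps)
  have "\<exists>x. v k - stop_seq \<alpha> \<beta> v k = clip (v k - \<beta>) (v k - \<alpha>) x"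
  proof (cases k)
    case 0
    then show ?thesis using w0 by blast
  next
    case (Suc j)
    then show ?thesis using wS[of j] by blast
  qed
  then obtain x where x: "v k - stop_seq \<alpha> \<beta> v k = clip (v k - \<beta>) (v k - \<alpha>) x" ..
  show "v k - stop_seq \<alpha> \<beta> v k = clip (v k - \<beta>) (v k - \<alpha>) (v k - stop_seq \<alpha> \<beta> v k)"
    unfolding x using assms by (auto simp: clip_def)
qed

context play_input
begin

text \<open>Both evolutions are compositions of clippings, which are non-expansive in the thresholds
  and in the argument simultaneously.\<close>

lemma play_near_constant:
  assumes W: "play T \<alpha> \<beta> \<pi> \<delta> W" and ab: "0 \<le> a" "b \<le> T"
    and near: "\<And>r. a \<le> r \<Longrightarrow> r \<le> b \<Longrightarrow> \<bar>\<pi> r - c\<bar> \<le> m"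
    and start: "\<bar>W a - x\<bar> \<le> m" and x: "x = clip (c - \<beta>) (c - \<alpha>) x"
    and s: "a \<le> s" "s \<le> b"
  shows "\<bar>W s - x\<bar> \<le> m"
proof -
  have "\<forall>s. a \<le> s \<longrightarrow> s \<le> b \<longrightarrow> s \<le> a + real n * (\<delta> / 2) \<longrightarrow> \<bar>W s - x\<bar> \<le> m" for n
  proof (induction n)
    case 0
    then show ?case using start by (auto dest: order.antisym)
  next
    case (Suc n)
    show ?case
    proof (intro allI impI)
      fix s assume s: "a \<le> s" "s \<le> b" "s \<le> a + real (Suc n) * (\<delta> / 2)"
      \<comment> \<open>Start of a window ending at \<open>s\<close> that is short enough for the
        closed form and whose left end is covered by the induction hypothesis.\<close>
      define q where "q = max a (s - \<delta> / 2)"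
      have q: "a \<le> q" "q \<le> s" "s - q < \<delta>" "q \<le> a + real n * (\<delta> / 2)"
        using s \<delta> by (auto simp: q_def max_def field_simps)
      have IH: "\<bar>W q - x\<bar> \<le> m" using Suc q s by auto
      have mem: "c - m \<le> \<pi> r \<and> \<pi> r \<le> c + m" if "q \<le> r" "r \<le> s" for r
        using near[of r] that q s by auto
      have S: "\<bar>Sup (\<pi> ` {q..s}) - c\<bar> \<le> m"
        using Sup_least[OF q(2), of "c + m"] Sup_upper[of q s s] mem mem[of s] q s ab by fastforce
      have I: "\<bar>Inf (\<pi> ` {q..s}) - c\<bar> \<le> m"
        using Inf_greatest[OF q(2), of "c - m"] Inf_lower[of q s s] mem mem[of s] q s ab by fastforce
      have Ws: "W s = clip (Sup (\<pi> ` {q..s}) - \<beta>) (Inf (\<pi> ` {q..s}) - \<alpha>) (W q)"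
        using q s ab by (intro playD[OF W]) auto
      show "\<bar>W s - x\<bar> \<le> m"
        \<comment> \<open>Writing \<open>x\<close> as a clipping of itself puts both sides into the
          form required by \<open>abs_clip_diff_le\<close>.\<close>
        by (subst Ws, subst x, intro abs_clip_diff_le) (use S I IH in auto)
    qed
  qed
  moreover obtain n where "s - a < real n * (\<delta> / 2)"
    using reals_Archimedean3[of "\<delta> / 2"] \<delta> half_gt_zero by blast
  then have "s \<le> a + real n * (\<delta> / 2)" by simp
  ultimately show ?thesis using s by blast
qed

text \<open>Along a piece the error persists by \<open>play_near_constant\<close>. At a node the
  decoder clips its old value to the new interval, while \<open>W\<close> is unchanged by clipping
  to the interval of \<open>\<pi>\<close> at that time; so both sides are clippings and the bound
  \<open>m\<close> survives the jump.\<close>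

lemma play_step_error:
  assumes W: "play T \<alpha> \<beta> \<pi> \<delta> W" and z: "step_repr T M t v z"
    and near: "\<And>s. s \<in> {0..<T} \<Longrightarrow> \<bar>\<pi> s - z s\<bar> \<le> m"
    and k: "k < M" and s: "s \<in> {t k..t (Suc k)}"
  shows "\<bar>W s - (v k - stop_seq \<alpha> \<beta> v k)\<bar> \<le> m"
proof -
  define w where "w k = v k - stop_seq \<alpha> \<beta> v k" for k
  note clip_w = stop_seq_clip[OF less_imp_le[OF \<alpha>\<beta>], of v, folded w_def]
  note nodes = step_repr_nodes(1)[OF z]
  have z': "t 0 = 0" "t M = T" "\<And>k. k < M \<Longrightarrow> t k < t (Suc k)"
    "\<And>k s. k < M \<Longrightarrow> s \<in> {t k..<t (Suc k)} \<Longrightarrow> z s = v k"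
    using z by (auto simp: step_repr_def)
  \<comment> \<open>Continuity of \<open>\<pi>\<close> extends the bound to the right end point,
    where \<open>z\<close> already has its next value. At an interior node \<open>\<pi>\<close> is
    therefore close to the values on both sides.\<close>
  have near': "\<bar>\<pi> r - v k\<bar> \<le> m" if k: "k < M" and r: "t k \<le> r" "r \<le> t (Suc k)" for k r
  proof -
    have sub: "{t k..t (Suc k)} \<subseteq> {0..T}" using nodes[of k] nodes[of "Suc k"] k by auto
    have cl: "closure {t k..<t (Suc k)} = {t k..t (Suc k)}"
      using z'(3)[OF k] by (rule closure_atLeastLessThan)
    have cont': "continuous_on (closure {t k..<t (Suc k)}) (\<lambda>r. \<pi> r - v k)"
      unfolding cl using sub by (intro continuous_intros continuous_on_subset[OF cont])
    have bound: "\<forall>y\<in>{t k..<t (Suc k)}. norm (\<pi> y - v k) \<le> m"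
    proof
      fix y assume y: "y \<in> {t k..<t (Suc k)}"
      then have "y \<in> {0..<T}" using nodes[of k] nodes[of "Suc k"] k by auto
      then show "norm (\<pi> y - v k) \<le> m" using near z'(4)[OF k y] by fastforce
    qed
    show ?thesis
      using continuous_on_closure_norm_le[OF cont' bound, of r] r unfolding cl by auto
  qed
  have step: "\<bar>W s - w k\<bar> \<le> m" if "\<bar>W (t k) - w k\<bar> \<le> m" "k < M" "t k \<le> s" "s \<le> t (Suc k)" for k s
    by (rule play_near_constant[OF W _ _ near'[OF that(2)] that(1) clip_w(3) that(3,4)])
      (use nodes[of k] nodes[of "Suc k"] that(2) in auto)
  have "\<bar>W (t k) - w k\<bar> \<le> m" if "k < M" for k
    using that
  proof (induction k)
    case 0
    have "W 0 = clip (\<pi> 0 - \<beta>) (\<pi> 0 - \<alpha>) 0"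
      using W \<alpha>\<beta> by (simp add: play_def closest_point_Icc diff_clip)
    moreover have "\<bar>\<pi> 0 - v 0\<bar> \<le> m" using near'[OF 0, of 0] z'(1) z'(3)[OF 0] by simp
    moreover from this have "0 \<le> m" by linarith
    ultimately show ?case
      unfolding clip_w(1) z'(1) by (simp only:, intro abs_clip_diff_le) auto
  next
    case (Suc k)
    have "k < M" using Suc.prems by simp
    then have prev: "\<bar>W (t (Suc k)) - w k\<bar> \<le> m"
      using step[OF Suc.IH[OF \<open>k < M\<close>] \<open>k < M\<close>, of "t (Suc k)"] z'(3)[OF \<open>k < M\<close>] by simp
    have \<pi>: "\<bar>\<pi> (t (Suc k)) - v (Suc k)\<bar> \<le> m"
      using near'[OF Suc.prems, of "t (Suc k)"] z'(3)[OF Suc.prems] by simp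
    have "t (Suc k) \<in> {0..T}" using nodes[of "Suc k"] Suc.prems by simp
    then show ?case
      by (subst play_clip_self[OF W], assumption, subst clip_w(2), intro abs_clip_diff_le)
        (use prev \<pi> in auto)
  qed
  from step[OF this[OF k] k] s show ?thesis by (auto simp: w_def)
qed

end

subsection \<open>The minimax error\<close>

lemma compl_var_play:
  assumes "0 < T" "\<alpha> < \<beta>" "\<pi> \<in> W11 T"
  obtains \<delta> W where "play_input T \<alpha> \<beta> \<delta> \<pi>" "play T \<alpha> \<beta> \<pi> \<delta> W" "continuous_on {0..T} W"
    "\<And>t. t \<in> {0..T} \<Longrightarrow> compl_var T \<alpha> \<beta> \<pi> t = W t"
proof -
  have ac: "absolutely_continuous_fun 0 T \<pi>" using assms(3) by (simp add: W11_def)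
  obtain \<delta> where "play_input T \<alpha> \<beta> \<delta> \<pi>" using play_input_exists[OF assms(1,2) ac] .
  then interpret play_input T \<alpha> \<beta> \<delta> \<pi> .
  obtain W where W: "play T \<alpha> \<beta> \<pi> \<delta> W" using play_exists by blast
  show thesis
    using that[OF \<open>play_input T \<alpha> \<beta> \<delta> \<pi>\<close> W] compl_var_eq_play[OF W ac]
      absolutely_continuous_fun_imp_continuous_on[OF absolutely_continuous_play[OF W ac]] by blast
qed

lemma Linf_error_le:
  assumes "0 < T" "\<alpha> < \<beta>" "\<pi> \<in> W11 T" "f \<pi> \<in> step_functions T N"
    and near: "\<And>s. s \<in> {0..<T} \<Longrightarrow> \<bar>\<pi> s - f \<pi> s\<bar> \<le> m"
  shows "Linf_norm T (\<lambda>t. compl_var T \<alpha> \<beta> \<pi> t - decoded_compl_var T \<alpha> \<beta> N f \<pi> t) \<le> ereal m"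
proof -
  obtain \<delta> W where pi: "play_input T \<alpha> \<beta> \<delta> \<pi>" and W: "play T \<alpha> \<beta> \<pi> \<delta> W"
    and contW: "continuous_on {0..T} W" and eq: "\<And>t. t \<in> {0..T} \<Longrightarrow> compl_var T \<alpha> \<beta> \<pi> t = W t"
    using compl_var_play[OF assms(1-3)] by metis
  interpret play_input T \<alpha> \<beta> \<delta> \<pi> by (rule pi)
  obtain M t v where Mtv: "M \<le> N" "step_repr T M t v (f \<pi>)" and
    d: "step_repr T M t (\<lambda>k. v k - stop_seq \<alpha> \<beta> v k) (decoded_compl_var T \<alpha> \<beta> N f \<pi>)"
    using decoded_compl_var_step_repr[where f = f and \<pi> = \<pi>, OF assms(4)] by metis
  let ?M = "lebesgue_on {0<..<T}"
  have "continuous_on {0<..<T} W" by (rule continuous_on_subset[OF contW]) auto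
  then have "W \<in> borel_measurable ?M"
    by (rule continuous_imp_measurable_on_sets_lebesgue) simp
  then have "compl_var T \<alpha> \<beta> \<pi> \<in> borel_measurable ?M"
    by (subst measurable_cong[of _ "compl_var T \<alpha> \<beta> \<pi>" W]) (auto simp: eq)
  then have "(\<lambda>t. ereal \<bar>compl_var T \<alpha> \<beta> \<pi> t - decoded_compl_var T \<alpha> \<beta> N f \<pi> t\<bar>)
      \<in> borel_measurable ?M"
    using step_repr_measurable[OF d] by measurable
  moreover have "\<bar>compl_var T \<alpha> \<beta> \<pi> s - decoded_compl_var T \<alpha> \<beta> N f \<pi> s\<bar> \<le> m"
    if "s \<in> {0<..<T}" for s
  proof -
    have s: "s \<in> {0..<T}" using that by auto
    then obtain k where k: "k < M" "s \<in> {t k..<t (Suc k)}"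
      using step_repr_nodes(2)[OF d] by blast
    have "decoded_compl_var T \<alpha> \<beta> N f \<pi> s = v k - stop_seq \<alpha> \<beta> v k"
      using d k unfolding step_repr_def by blast
    then show ?thesis
      using play_step_error[OF W Mtv(2) near k(1), of s] k(2) s eq[of s] by auto
  qed
  then have "AE s in ?M. ereal \<bar>compl_var T \<alpha> \<beta> \<pi> s - decoded_compl_var T \<alpha> \<beta> N f \<pi> s\<bar> \<le> ereal m"
    by (intro AE_I2) auto
  ultimately show ?thesis unfolding Linf_norm_def by (rule esssup_I)
qed

section \<open>The lower bound for an arbitrary encoder\<close>

lemma continuous_AE_bound_closed_interval:
  fixes g :: "real \<Rightarrow> real"
  assumes "a < b" "continuous_on {a..b} g" "negligible E"
    and "\<And>s. s \<in> {a<..<b} \<Longrightarrow> s \<notin> E \<Longrightarrow> \<bar>g s\<bar> \<le> e" and "x \<in> {a..b}"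
  shows "\<bar>g x\<bar> \<le> e"
proof -
  \<comment> \<open>A null set has no interior, so the points where the bound is known are dense in
    the interval and continuity carries it to the end points.\<close>
  have "interior E = {}"
    using open_not_negligible[OF open_interior] negligible_subset[OF assms(3) interior_subset] by blast
  then have "closure (- E) = UNIV" by (simp add: closure_complement)
  then have "closure ({a<..<b} \<inter> - E) = closure {a<..<b}"
    by (intro closure_open_Int_superset) auto
  then have cl: "closure ({a<..<b} \<inter> - E) = {a..b}"
    using assms(1) by simp
  have "norm (g x) \<le> e"
    using continuous_on_closure_norm_le[of "{a<..<b} \<inter> - E" g e x] assms unfolding cl by auto
  then show ?thesis by simp
qed

text \<open>The source of the factor \<open>2 * N\<close>: on a closed piece both end values of
  \<open>W\<close> are within \<open>e\<close> of the same constant. The jumps of the decoded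
  function do not enter, since the increments of the continuous \<open>W\<close> telescope over the
  shared nodes.\<close>

lemma compl_var_increment_le:
  assumes "0 < T" "\<alpha> < \<beta>" "\<pi> \<in> W11 T" "f \<pi> \<in> step_functions T N" "0 \<le> e"
    and le: "Linf_norm T (\<lambda>t. compl_var T \<alpha> \<beta> \<pi> t - decoded_compl_var T \<alpha> \<beta> N f \<pi> t) \<le> ereal e"
  shows "compl_var T \<alpha> \<beta> \<pi> T - compl_var T \<alpha> \<beta> \<pi> 0 \<le> 2 * real N * e"
proof -
  obtain \<delta> W where cont: "continuous_on {0..T} W"
    and eq: "\<And>t. t \<in> {0..T} \<Longrightarrow> compl_var T \<alpha> \<beta> \<pi> t = W t"
    using compl_var_play[OF assms(1-3)] by metis
  obtain M t v where "M \<le> N" and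
    d: "step_repr T M t (\<lambda>k. v k - stop_seq \<alpha> \<beta> v k) (decoded_compl_var T \<alpha> \<beta> N f \<pi>)"
    using decoded_compl_var_step_repr[where f = f and \<pi> = \<pi>, OF assms(4)] by metis
  define w where "w k = v k - stop_seq \<alpha> \<beta> v k" for k
  let ?r = "\<lambda>t. compl_var T \<alpha> \<beta> \<pi> t - decoded_compl_var T \<alpha> \<beta> N f \<pi> t"
  have "AE s in lebesgue_on {0<..<T}. ereal \<bar>?r s\<bar>
      \<le> Linf_norm T ?r"
    unfolding Linf_norm_def by (rule esssup_AE)
  then have "AE s in lebesgue_on {0<..<T}. \<bar>?r s\<bar> \<le> e"
    by eventually_elim (use le in \<open>metis ereal_less_eq(3) order_trans\<close>)
  then have E: "negligible {s \<in> {0<..<T}. \<not> \<bar>?r s\<bar> \<le> e}" (is "negligible ?E")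
    by (subst (asm) AE_lebesgue_on_iff_negligible) auto
  note nodes = step_repr_nodes(1)[OF d]
  have "W (t (Suc k)) - W (t k) \<le> 2 * e" if k: "k < M" for k
  proof -
    have less: "t k < t (Suc k)" using d k by (simp add: step_repr_def)
    have sub: "{t k..t (Suc k)} \<subseteq> {0..T}" using nodes[of k] nodes[of "Suc k"] k by auto
    have "\<bar>W x - w k\<bar> \<le> e" if x: "x \<in> {t k..t (Suc k)}" for x
    proof (rule continuous_AE_bound_closed_interval[OF less _ E _ x])
      show "continuous_on {t k..t (Suc k)} (\<lambda>x. W x - w k)"
        using sub by (intro continuous_intros continuous_on_subset[OF cont])
      fix s assume s: "s \<in> {t k<..<t (Suc k)}" "s \<notin> ?E"
      then have "s \<in> {0<..<T}" using nodes[of k] nodes[of "Suc k"] k by auto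
      moreover have "decoded_compl_var T \<alpha> \<beta> N f \<pi> s = w k"
        using d k s(1) by (simp add: step_repr_def w_def)
      ultimately show "\<bar>W s - w k\<bar> \<le> e" using s(2) eq[of s] by simp
    qed
    from this[of "t k"] this[of "t (Suc k)"] show ?thesis using less by auto
  qed
  then have "(\<Sum>k<M. W (t (Suc k)) - W (t k)) \<le> (\<Sum>k<M. 2 * e)"
    by (intro sum_mono) auto
  then have "W T - W 0 \<le> 2 * real M * e"
    using sum_lessThan_telescope[of "\<lambda>k. W (t k)" M] d by (simp add: step_repr_def)
  also have "\<dots> \<le> 2 * real N * e"
    using \<open>M \<le> N\<close> \<open>0 \<le> e\<close> by (intro mult_right_mono) auto
  finally show ?thesis using eq[of 0] eq[of T] assms(1) by simp
qed

lemma linear_W11: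
  assumes "0 \<le> c"
  shows "(\<lambda>t\<in>{0..T}. c * t) \<in> W11 T"
proof -
  have "\<exists>\<delta>>0. \<forall>(n::nat) x y. (\<forall>i<n. 0 \<le> x i \<and> x i \<le> y i \<and> y i \<le> T) \<and>
      disjoint_family_on (\<lambda>i. {x i<..<y i}) {..<n} \<and> (\<Sum>i<n. y i - x i) < \<delta> \<longrightarrow>
      (\<Sum>i<n. \<bar>(\<lambda>t\<in>{0..T}. c * t) (y i) - (\<lambda>t\<in>{0..T}. c * t) (x i)\<bar>) < e" if "0 < e" for e
  \<comment> \<open>Dividing by \<open>c + 1\<close> covers \<open>c = 0\<close> and makes the final
    inequality strict.\<close>
  proof (intro exI[of _ "e / (c + 1)"] conjI allI impI)
    show "0 < e / (c + 1)" using that assms by simp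
    fix n :: nat and x y :: "nat \<Rightarrow> real"
    assume *: "(\<forall>i<n. 0 \<le> x i \<and> x i \<le> y i \<and> y i \<le> T) \<and>
      disjoint_family_on (\<lambda>i. {x i<..<y i}) {..<n} \<and> (\<Sum>i<n. y i - x i) < e / (c + 1)"
    have "(\<Sum>i<n. \<bar>(\<lambda>t\<in>{0..T}. c * t) (y i) - (\<lambda>t\<in>{0..T}. c * t) (x i)\<bar>) = (\<Sum>i<n. c * (y i - x i))"
    proof (intro sum.cong refl)
      fix i assume "i \<in> {..<n}"
      then have "0 \<le> x i" "x i \<le> y i" "y i \<le> T" using * by auto
      then show "\<bar>(\<lambda>t\<in>{0..T}. c * t) (y i) - (\<lambda>t\<in>{0..T}. c * t) (x i)\<bar> = c * (y i - x i)"
        using assms by (simp add: right_diff_distrib[symmetric] abs_mult)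
    qed
    also have "\<dots> = c * (\<Sum>i<n. y i - x i)" by (simp add: sum_distrib_left)
    also have "\<dots> \<le> c * (e / (c + 1))" using * assms by (intro mult_left_mono) auto
    also have "\<dots> < e" using that assms by (simp add: field_simps)
    finally show "(\<Sum>i<n. \<bar>(\<lambda>t\<in>{0..T}. c * t) (y i) - (\<lambda>t\<in>{0..T}. c * t) (x i)\<bar>) < e" .
  qed
  then show ?thesis unfolding W11_def absolutely_continuous_fun_def by auto
qed

lemma norm_BV0_linear:
  assumes "0 \<le> c" "0 \<le> T"
  shows "norm_BV0 T (\<lambda>t\<in>{0..T}. c * t) = c * T"
proof -
  let ?u = "\<lambda>t\<in>{0..T}. c * t"
  have sums: "s = c * T" if s: "s \<in> partition_sums ?u 0 T" for s
  proof -
    obtain n t where t: "s = (\<Sum>j<n. \<bar>?u (t (Suc j)) - ?u (t j)\<bar>)"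
      "t 0 = 0" "t n = T" "\<forall>j<n. t j \<le> t (Suc j)"
      using s unfolding partition_sums_def by blast
    have "s = (\<Sum>j<n. c * t (Suc j) - c * t j)"
      unfolding t(1)
    proof (intro sum.cong refl)
      fix j assume j: "j \<in> {..<n}"
      then have "0 \<le> t j" "t j \<le> t (Suc j)" "t (Suc j) \<le> T"
        using partition_mono[OF t(4), of 0 j] partition_mono[OF t(4), of "Suc j" n] t by auto
      then show "\<bar>?u (t (Suc j)) - ?u (t j)\<bar> = c * t (Suc j) - c * t j"
        using assms(1) by (simp add: mult_left_mono)
    qed
    also have "\<dots> = c * T" using sum_lessThan_telescope[of "\<lambda>j. c * t j" n] t by simp
    finally show ?thesis .
  qed
  have mem: "\<bar>?u T - ?u 0\<bar> \<in> partition_sums ?u 0 T"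
    by (rule abs_diff_in_partition_sums[OF assms(2)])
  then have "c * T \<in> partition_sums ?u 0 T" by (simp only: sums[OF mem])
  then have "partition_sums ?u 0 T = {c * T}" using sums by blast
  then have "total_variation ?u 0 T = c * T" by (simp add: total_variation_alt)
  then show ?thesis using assms(2) by (simp add: norm_BV0_def)
qed

text \<open>On the ramp \<open>t \<mapsto> l t / T\<close> the complementary variable climbs by \<open>l\<close> up to a constant, and
  \<open>N\<close> steps resolve this climb only up to \<open>1 / (2 N)\<close> of it; the constant is negligible for
  large \<open>l\<close>.\<close>

lemma encoder_error_ge:
  assumes "0 < T" "\<alpha> < \<beta>" "N \<ge> 1" "f \<in> encoders T N"
  shows "ereal (1 / (2 * real N)) \<le> encoder_error T \<alpha> \<beta> N f"
proof (rule ccontr)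
  assume "\<not> ?thesis"
  then have "encoder_error T \<alpha> \<beta> N f < ereal (1 / (2 * real N))" by simp
  \<comment> \<open>A real number strictly in between leaves a gap to be exploited for large
    \<open>l\<close>; the maximum with 0 supplies the nonnegative error bound that
    \<open>compl_var_increment_le\<close> expects.\<close>
  then obtain q0 :: real where q0: "encoder_error T \<alpha> \<beta> N f < ereal q0" "ereal q0 < ereal (1 / (2 * real N))"
    by (meson ereal_dense2)
  define q where "q = max q0 0"
  have q: "0 \<le> q" "encoder_error T \<alpha> \<beta> N f \<le> ereal q" "2 * real N * q < 1"
    using q0 assms(3) by (auto simp: q_def max_def field_simps intro: order_trans less_imp_le)
  define w0 where "w0 = - closest_point {\<alpha>..\<beta>} (0::real)"
  have bound: "l - \<beta> - w0 \<le> 2 * real N * (q * l)" if "0 < l" for l :: real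
  proof -
    define \<pi> where "\<pi> = (\<lambda>t\<in>{0..T}. l / T * t)"
    have \<pi>: "\<pi> \<in> W11 T" unfolding \<pi>_def using that assms(1) by (intro linear_W11) simp
    have norm: "norm_BV0 T \<pi> = l"
      unfolding \<pi>_def using that assms(1) by (subst norm_BV0_linear) auto
    have "\<pi> T \<noteq> 0" using that assms(1) by (simp add: \<pi>_def)
    then have ne: "\<pi> \<noteq> (\<lambda>t\<in>{0..T}. 0)" using assms(1) by auto
    have f\<pi>: "f \<pi> \<in> step_functions T N" using assms(4) \<pi> by (auto simp: encoders_def)
    let ?L = "Linf_norm T (\<lambda>t. compl_var T \<alpha> \<beta> \<pi> t - decoded_compl_var T \<alpha> \<beta> N f \<pi> t)"
    have "?L / ereal l \<le> encoder_error T \<alpha> \<beta> N f"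
      unfolding encoder_error_def norm[symmetric] using \<pi> ne by (intro SUP_upper) auto
    then have "?L / ereal l \<le> ereal q" using q(2) by (rule order_trans)
    then have L: "?L \<le> ereal (q * l)"
      using that by (simp add: ereal_divide_le_pos mult.commute)
    obtain \<delta> W where pi: "play_input T \<alpha> \<beta> \<delta> \<pi>" and W: "play T \<alpha> \<beta> \<pi> \<delta> W"
      and eq: "\<And>t. t \<in> {0..T} \<Longrightarrow> compl_var T \<alpha> \<beta> \<pi> t = W t"
      using compl_var_play[OF assms(1,2) \<pi>] by metis
    interpret play_input T \<alpha> \<beta> \<delta> \<pi> by (rule pi)
    have "l - \<beta> \<le> W T" using play_bounds[OF W, of T] assms(1) by (simp add: \<pi>_def)
    moreover have "W 0 = w0" using W assms(1) by (simp add: play_def w0_def \<pi>_def)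
    moreover have "W T - W 0 \<le> 2 * real N * (q * l)"
      using compl_var_increment_le[of T \<alpha> \<beta> \<pi> f N, OF assms(1,2) \<pi> f\<pi> _ L] that q(1) eq[of 0] eq[of T] assms(1)
      by simp
    ultimately show ?thesis by simp
  qed
  \<comment> \<open>Chosen so that \<open>l * (1 - 2 * real N * q)\<close> equals
    \<open>\<bar>\<beta> + w0\<bar> + 1\<close>, which exceeds the bound \<open>\<beta> + w0\<close>
    obtained from the ramp of height \<open>l\<close>.\<close>
  define l where "l = (\<bar>\<beta> + w0\<bar> + 1) / (1 - 2 * real N * q)"
  have "0 < l" using q(3) by (simp add: l_def)
  from bound[OF this] have "l * (1 - 2 * real N * q) \<le> \<beta> + w0" by (simp add: algebra_simps)
  then show False using q(3) by (simp add: l_def)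
qed


section \<open>Nodes and samples of equal variation\<close>

context
  fixes T :: real and \<pi> :: "real \<Rightarrow> real" and N :: nat
  assumes T: "0 < T" and \<pi>: "\<pi> \<in> W11 T" and N: "N \<ge> 1"
begin

lemma W11_absolutely_continuous: "absolutely_continuous_fun 0 T \<pi>"
  using \<pi> by (simp add: W11_def)

lemma W11_bounded_variation: "bounded_variation \<pi> 0 T"
  using absolutely_continuous_fun_imp_bounded_variation[OF W11_absolutely_continuous] T by simp

text \<open>Reparametrised by its variation, \<open>\<pi>\<close> is 1-Lipschitz; distances between
  levels of the variation thus bound the sampling error.\<close>

lemma abs_diff_le_variation_diff:
  assumes "0 \<le> s" "s \<le> t" "t \<le> T"
  shows "\<bar>\<pi> t - \<pi> s\<bar> \<le> total_variation \<pi> 0 t - total_variation \<pi> 0 s"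
proof -
  have bv: "bounded_variation \<pi> 0 t" "bounded_variation \<pi> s t"
    using assms by (auto intro: bounded_variation_subinterval[OF W11_bounded_variation])
  show ?thesis
    using total_variation_add[OF bv(1) assms(1,2)] abs_diff_le_total_variation[OF bv(2) assms(2)]
    by simp
qed

text \<open>\<open>LEAST\<close> over the reals denotes a true minimum here: the level set of the
  continuous variation function is compact, and nonempty by the intermediate value theorem.\<close>

lemma equal_var_node_props:
  assumes V: "0 < total_variation \<pi> 0 T" and k: "k \<le> N"
  shows "equal_var_node T N \<pi> k \<in> {0..T}"
    and "total_variation \<pi> 0 (equal_var_node T N \<pi> k) = real k * total_variation \<pi> 0 T / real N"
    and "k = 0 \<Longrightarrow> equal_var_node T N \<pi> k = 0"
proof -
  let ?V = "total_variation \<pi> 0 T" and ?a = "total_variation \<pi> 0"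
  have least: "equal_var_node T N \<pi> k \<in> {0..T} \<and> ?a (equal_var_node T N \<pi> k) = real k * ?V / real N \<and>
      (\<forall>t\<in>{0..T}. ?a t = real k * ?V / real N \<longrightarrow> equal_var_node T N \<pi> k \<le> t)" if "k < N"
  proof -
    let ?y = "real k * ?V / real N"
    let ?S = "{t \<in> {0..T}. ?a t = ?y}"
    have cont: "continuous_on {0..T} ?a"
      by (rule continuous_on_total_variation[OF W11_absolutely_continuous])
    have y: "?a 0 \<le> ?y" "?y \<le> ?a T" using V that by (auto simp: field_simps)
    then have "\<exists>t\<ge>0. t \<le> T \<and> ?a t = ?y" using cont T by (intro IVT') auto
    then have "?S \<noteq> {}" by auto
    moreover have "closed ?S"
      by (rule continuous_closed_preimage_constant[OF cont]) simp
    moreover have "bounded ?S" by (rule bounded_subset[of "{0..T}"]) auto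
    ultimately obtain t0 where t0: "t0 \<in> ?S" "\<forall>t\<in>?S. t0 \<le> t"
      using compact_attains_inf[of ?S] by (auto simp: compact_eq_bounded_closed)
    then have "equal_var_node T N \<pi> k = t0"
      using that unfolding equal_var_node_def by (auto intro!: Least_equality)
    then show ?thesis using t0 by auto
  qed
  show "equal_var_node T N \<pi> k \<in> {0..T}"
    using least k T by (cases "k < N") (auto simp: equal_var_node_def)
  show "?a (equal_var_node T N \<pi> k) = real k * ?V / real N"
  proof (cases "k < N")
    case False
    then have "k = N" using k by simp
    then show ?thesis using N by (simp add: equal_var_node_def)
  qed (use least in auto)
  assume "k = 0"
  then have "equal_var_node T N \<pi> k \<in> {0..T}" "equal_var_node T N \<pi> k \<le> 0"
    using least N T by auto
  then show "equal_var_node T N \<pi> k = 0" by simp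
qed

lemma equal_var_node_less:
  assumes V: "0 < total_variation \<pi> 0 T" and k: "k < N"
  shows "equal_var_node T N \<pi> k < equal_var_node T N \<pi> (Suc k)"
proof (rule ccontr)
  assume "\<not> ?thesis"
  then have "total_variation \<pi> 0 (equal_var_node T N \<pi> (Suc k)) \<le> total_variation \<pi> 0 (equal_var_node T N \<pi> k)"
    using abs_diff_le_variation_diff[of "equal_var_node T N \<pi> (Suc k)" "equal_var_node T N \<pi> k"]
      equal_var_node_props(1)[OF V, of k] equal_var_node_props(1)[OF V, of "Suc k"] k by simp
  then have "real (Suc k) * total_variation \<pi> 0 T / real N \<le> real k * total_variation \<pi> 0 T / real N"
    using equal_var_node_props(2)[OF V, of k] equal_var_node_props(2)[OF V, of "Suc k"] k by simp
  moreover have "real k * total_variation \<pi> 0 T / real N < real (Suc k) * total_variation \<pi> 0 T / real N"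
    using V N by (intro divide_strict_right_mono mult_strict_right_mono) auto
  ultimately show False by linarith
qed

lemma equal_var_node_last: "equal_var_node T N \<pi> N = T"
  by (simp add: equal_var_node_def)

lemma equal_var_sample_exists: "\<exists>z. equal_var_sample T N \<pi> z"
proof (cases "total_variation \<pi> 0 T = 0")
  case True
  then have "equal_var_sample T N \<pi> (\<lambda>t\<in>{0..T}. \<pi> 0)" by (simp add: equal_var_sample_def)
  then show ?thesis by blast
next
  case False
  then have V: "0 < total_variation \<pi> 0 T"
    using total_variation_nonneg[OF W11_bounded_variation] T by simp
  let ?V = "total_variation \<pi> 0 T" and ?a = "total_variation \<pi> 0" and ?t = "equal_var_node T N \<pi>"
  \<comment> \<open>The required level is the midpoint of the levels \<open>(k - 1) * V / N\<close>
    and \<open>k * V / N\<close> at the two nodes.\<close>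
  have "\<forall>k\<in>{1..N}. \<exists>\<tau>. \<tau> \<in> {?t (k - 1)..?t k} \<and> ?a \<tau> = (2 * real k - 1) * ?V / (2 * real N)"
  proof
    fix k assume k: "k \<in> {1..N}"
    have "{?t (k - 1)..?t k} \<subseteq> {0..T}"
      using equal_var_node_props(1)[OF V, of "k - 1"] equal_var_node_props(1)[OF V, of k] k by auto
    then have cont: "continuous_on {?t (k - 1)..?t k} ?a"
      by (rule continuous_on_subset[OF continuous_on_total_variation[OF W11_absolutely_continuous]])
    have k': "k - 1 \<le> N" "k \<le> N" "real (k - 1) = real k - 1" using k by auto
    have N': "0 < real N" using N by simp
    have "?a (?t (k - 1)) \<le> (2 * real k - 1) * ?V / (2 * real N)"
      "(2 * real k - 1) * ?V / (2 * real N) \<le> ?a (?t k)"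
      unfolding equal_var_node_props(2)[OF V k'(1)] equal_var_node_props(2)[OF V k'(2)] k'(3)
      using V N' by (simp_all add: field_simps)
    moreover have "k - 1 < N" "Suc (k - 1) = k" using k by auto
    then have "?t (k - 1) \<le> ?t k" using equal_var_node_less[OF V, of "k - 1"] by simp
    ultimately show "\<exists>\<tau>. \<tau> \<in> {?t (k - 1)..?t k} \<and> ?a \<tau> = (2 * real k - 1) * ?V / (2 * real N)"
      using IVT'[of ?a "?t (k - 1)" _ "?t k"] cont by auto
  qed
  then obtain \<tau> where \<tau>: "\<And>k. k \<in> {1..N} \<Longrightarrow>
      \<tau> k \<in> {?t (k - 1)..?t k} \<and> ?a (\<tau> k) = (2 * real k - 1) * ?V / (2 * real N)"
    by metis
  \<comment> \<open>Pieces are numbered from 0 and sampling points from 1, hence the shift by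
    \<open>Suc\<close>; the value with index \<open>N\<close> is the one at time
    \<open>T\<close>.\<close>
  obtain z where z: "step_repr T N ?t (\<lambda>k. if k < N then \<pi> (\<tau> (Suc k)) else \<pi> T) z"
    using step_repr_exists[of ?t N T] equal_var_node_props(3)[OF V, of 0] equal_var_node_last
      equal_var_node_less[OF V] by blast
  have "z t = \<pi> (\<tau> k)" if "k \<in> {1..N}" "t \<in> {?t (k - 1)..<?t k}" for k t
  proof -
    have "k - 1 < N" "Suc (k - 1) = k" using that(1) by auto
    then show ?thesis using z that(2) unfolding step_repr_def by metis
  qed
  moreover have "z T = \<pi> T" "z \<in> extensional {0..T}" using z by (auto simp: step_repr_def)
  ultimately have "equal_var_sample T N \<pi> z"
    unfolding equal_var_sample_def if_not_P[OF False] using \<tau> by blast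
  then show ?thesis by blast
qed

text \<open>On a piece the variation covers an interval of levels of length \<open>V / N\<close> and
  the sample sits at its middle, so no level is farther away than
  \<open>V / (2 * N)\<close>.\<close>

lemma equal_var_sample_near:
  assumes z: "equal_var_sample T N \<pi> z"
  shows "z \<in> step_functions T N"
    and "\<And>s. s \<in> {0..<T} \<Longrightarrow> \<bar>\<pi> s - z s\<bar> \<le> total_variation \<pi> 0 T / (2 * real N)"
proof -
  let ?V = "total_variation \<pi> 0 T" and ?a = "total_variation \<pi> 0" and ?t = "equal_var_node T N \<pi>"
  have "z \<in> step_functions T N \<and> (\<forall>s\<in>{0..<T}. \<bar>\<pi> s - z s\<bar> \<le> ?V / (2 * real N))"
  proof (cases "?V = 0")
    case True
    then have z': "z \<in> extensional {0..T}" "\<And>t. t \<in> {0..T} \<Longrightarrow> z t = \<pi> 0"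
      using z by (auto simp: equal_var_sample_def)
    \<comment> \<open>A constant still takes one piece, which fits because
      \<open>N \<ge> 1\<close>.\<close>
    have "step_repr T 1 (\<lambda>k. if k = 0 then 0 else T) (\<lambda>_. \<pi> 0) z"
      using z' T by (auto simp: step_repr_def)
    then have "z \<in> step_functions T N" using N by (auto simp: step_functions_def)
    moreover have "\<pi> s = \<pi> 0" if "s \<in> {0..T}" for s
      using abs_diff_le_variation_diff[of 0 s] abs_diff_le_variation_diff[of s T] True that by auto
    then have "\<bar>\<pi> s - z s\<bar> = 0" if "s \<in> {0..<T}" for s
      using z'(2)[of s] that by (metis abs_zero atLeastAtMost_iff atLeastLessThan_iff diff_self less_imp_le)
    ultimately show ?thesis using True by simp
  next
    case False
    then have V: "0 < ?V" using total_variation_nonneg[OF W11_bounded_variation] T by simp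
    obtain \<tau> where \<tau>: "\<And>k. k \<in> {1..N} \<Longrightarrow> \<tau> k \<in> {?t (k - 1)..?t k} \<and>
        ?a (\<tau> k) = (2 * real k - 1) * ?V / (2 * real N) \<and>
        (\<forall>t\<in>{?t (k - 1)..<?t k}. z t = \<pi> (\<tau> k))" and zT: "z T = \<pi> T"
      using z unfolding equal_var_sample_def if_not_P[OF False] by blast
    have repr: "step_repr T N ?t (\<lambda>k. if k < N then \<pi> (\<tau> (Suc k)) else \<pi> T) z"
      unfolding step_repr_def
    proof (intro conjI allI impI ballI)
      show "?t 0 = 0" using equal_var_node_props(3)[OF V, of 0] by simp
      show "?t N = T" by (rule equal_var_node_last)
      show "z \<in> extensional {0..T}" using z by (simp add: equal_var_sample_def)
      show "z T = (if N < N then \<pi> (\<tau> (Suc N)) else \<pi> T)" using zT by simp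
      fix k assume k: "k < N"
      show "?t k < ?t (Suc k)" by (rule equal_var_node_less[OF V k])
      show "z s = (if k < N then \<pi> (\<tau> (Suc k)) else \<pi> T)" if "s \<in> {?t k..<?t (Suc k)}" for s
        using \<tau>[of "Suc k"] k that by simp
    qed
    have "\<bar>\<pi> s - z s\<bar> \<le> ?V / (2 * real N)" if s: "s \<in> {0..<T}" for s
    proof -
      obtain k where k: "k < N" "s \<in> {?t k..<?t (Suc k)}" using step_repr_nodes(2)[OF repr s] by blast
      note t1 = equal_var_node_props[OF V, of k] and t2 = equal_var_node_props[OF V, of "Suc k"]
      note \<tau>k = \<tau>[of "Suc k"]
      have \<tau>0: "\<tau> (Suc k) \<in> {0..T}" using \<tau>k t1(1) t2(1) k by auto
      have "\<bar>\<pi> s - \<pi> (\<tau> (Suc k))\<bar> \<le> \<bar>?a s - ?a (\<tau> (Suc k))\<bar>"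
        using abs_diff_le_variation_diff[of s "\<tau> (Suc k)"] abs_diff_le_variation_diff[of "\<tau> (Suc k)" s]
          \<tau>0 s by (cases "s \<le> \<tau> (Suc k)") auto
      also have "?a (?t k) \<le> ?a s" "?a s \<le> ?a (?t (Suc k))"
        using abs_diff_le_variation_diff[of "?t k" s] abs_diff_le_variation_diff[of s "?t (Suc k)"]
          t1(1) t2(1) k by auto
      then have "real k * ?V / real N \<le> ?a s" "?a s \<le> real (Suc k) * ?V / real N"
        using t1(2) t2(2) k by auto
      then have "\<bar>?a s - (2 * real (Suc k) - 1) * ?V / (2 * real N)\<bar> \<le> ?V / (2 * real N)"
        using N by (auto simp: abs_le_iff field_simps)
      then have "\<bar>?a s - ?a (\<tau> (Suc k))\<bar> \<le> ?V / (2 * real N)" using \<tau>k k by simp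
      finally show ?thesis using \<tau>k k by simp
    qed
    then show ?thesis using repr unfolding step_functions_def by blast
  qed
  then show "z \<in> step_functions T N"
    "\<And>s. s \<in> {0..<T} \<Longrightarrow> \<bar>\<pi> s - z s\<bar> \<le> ?V / (2 * real N)" by auto
qed

lemma norm_BV0_pos:
  assumes "\<pi> \<noteq> (\<lambda>t\<in>{0..T}. 0)"
  shows "0 < norm_BV0 T \<pi>"
proof (rule ccontr)
  assume "\<not> ?thesis"
  moreover have V: "0 \<le> total_variation \<pi> 0 T"
    using total_variation_nonneg[OF W11_bounded_variation] T by simp
  ultimately have 0: "\<pi> 0 = 0" "total_variation \<pi> 0 T = 0" by (auto simp: norm_BV0_def)
  have "\<pi> s = 0" if "s \<in> {0..T}" for s
    using abs_diff_le_variation_diff[of 0 s] abs_diff_le_variation_diff[of s T] 0 that by auto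
  then have "\<pi> = (\<lambda>t\<in>{0..T}. 0)"
    using \<pi> by (intro extensionalityI[of _ "{0..T}"]) (auto simp: W11_def)
  then show False using assms by simp
qed

end

section \<open>Optimality of the equal-variation encoder\<close>

lemma equal_var_encoder_encoders:
  assumes "0 < T" "N \<ge> 1" "equal_var_encoder T N f"
  shows "f \<in> encoders T N"
  using assms equal_var_sample_near(1) by (auto simp: encoders_def equal_var_encoder_def)

lemma equal_var_encoder_error_le:
  assumes "0 < T" "\<alpha> < \<beta>" "N \<ge> 1" and f: "equal_var_encoder T N f"
  shows "encoder_error T \<alpha> \<beta> N f \<le> ereal (1 / (2 * real N))"
  unfolding encoder_error_def
proof (rule SUP_least)
  fix \<pi> assume \<pi>: "\<pi> \<in> W11 T - {\<lambda>t\<in>{0..T}. 0}"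
  then have \<pi>W: "\<pi> \<in> W11 T" by simp
  let ?L = "Linf_norm T (\<lambda>t. compl_var T \<alpha> \<beta> \<pi> t - decoded_compl_var T \<alpha> \<beta> N f \<pi> t)"
  let ?V = "total_variation \<pi> 0 T" and ?n = "norm_BV0 T \<pi>"
  have z: "equal_var_sample T N \<pi> (f \<pi>)" using f \<pi>W by (simp add: equal_var_encoder_def)
  note near = equal_var_sample_near[OF assms(1) \<pi>W assms(3) z]
  have L: "?L \<le> ereal (?V / (2 * real N))"
    by (rule Linf_error_le[where f = f and \<pi> = \<pi>, OF assms(1,2) \<pi>W near])
  have n: "0 < ?n" using norm_BV0_pos[OF assms(1) \<pi>W assms(3)] \<pi> by simp
  have "?L / ereal ?n \<le> ereal (?V / (2 * real N)) / ereal ?n"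
    using L n by (intro ereal_divide_right_mono) auto
  also have "\<dots> = ereal (?V / (2 * real N) / ?n)" using n by simp
  also have "\<dots> \<le> ereal (1 / (2 * real N))"
  proof -
    have "?V \<le> ?n" by (simp add: norm_BV0_def)
    then have "?V / ?n \<le> 1" using n by simp
    then have "(?V / ?n) / (2 * real N) \<le> 1 / (2 * real N)" by (intro divide_right_mono) auto
    then show ?thesis by (simp add: mult.commute)
  qed
  finally show "?L / ereal ?n \<le> ereal (1 / (2 * real N))" .
qed

theorem theorem3p12:
  fixes T \<alpha> \<beta> :: real and N :: nat
  assumes "T > 0" and "\<alpha> < \<beta>" and "N \<ge> 1"
  shows "minimax_error T \<alpha> \<beta> N = ereal (1 / (2 * real N))
    \<and> (\<exists>f. equal_var_encoder T N f)
    \<and> (\<forall>f. equal_var_encoder T N f \<longrightarrow>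
          f \<in> encoders T N \<and> encoder_error T \<alpha> \<beta> N f = minimax_error T \<alpha> \<beta> N)"
proof -
  have lower: "ereal (1 / (2 * real N)) \<le> minimax_error T \<alpha> \<beta> N"
    unfolding minimax_error_def using encoder_error_ge[OF assms] by (rule INF_greatest)
  have upper: "minimax_error T \<alpha> \<beta> N \<le> encoder_error T \<alpha> \<beta> N f" if "f \<in> encoders T N" for f
    unfolding minimax_error_def using that by (rule INF_lower)
  have opt: "f \<in> encoders T N \<and> encoder_error T \<alpha> \<beta> N f = minimax_error T \<alpha> \<beta> N
      \<and> minimax_error T \<alpha> \<beta> N = ereal (1 / (2 * real N))" if "equal_var_encoder T N f" for f
    using equal_var_encoder_encoders[OF assms(1,3) that] equal_var_encoder_error_le[OF assms that]
      upper[of f] lower by auto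
  \<comment> \<open>Choosing a sample for every input produces an actual encoder, and its error
    bounds the infimum from above.\<close>
  have "\<forall>\<pi>\<in>W11 T. \<exists>z. equal_var_sample T N \<pi> z"
    using equal_var_sample_exists[OF assms(1) _ assms(3)] by blast
  then obtain f where f: "equal_var_encoder T N f"
    unfolding equal_var_encoder_def by metis
  then show ?thesis using opt by blast
qed

end
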